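(* Let $\mathfrak g$ be a solvable singular quadratic Lie algebra. Then $\mathfrak g$ is an invertible quadratic Lie algebra if and only if $\mathfrak g$ is an amalgamated product of Lie algebras all i-isomorphic to Jordan-type Lie algebras $\mathfrak j_{2p}(\lambda)$ with $\lambda\ne0$ (where $p\ge1$ and $\lambda\in\mathbb C$ may vary from factor to factor).
   Context: All vector spaces are finite-dimensional over $\mathbb C$. A quadratic Lie algebra $(\mathfrak g,B)$ is a Lie algebra with a non-degenerate symmetric invariant bilinear form. An i-isomorphism is a Lie algebra isomorphism that is an isometry. Let $I(X,Y,Z)=B([X,Y],Z)$ and $\mathrm{dup}(\mathfrak g)=\dim\{\alpha\in\mathfrak g^*\mid\alpha\wedge I=0\}$; a non-Abelian quadratic Lie algebra is singular if $\mathrm{dup}(\mathfrak g)\ge1$. Double extension of a quadratic vector space $(\mathfrak q,B_{\mathfrak q})$ (non-degenerate symmetric form) by a skew-symmetric map $\overline C$: the orthogonal direct sum $(\mathbb CX_0\oplus\mathbb CY_0)\oplus\mathfrak q$, with form $B$ extending $B_{\mathfrak q}$ and $B(X_0,X_0)=B(Y_0,Y_0)=0$, $B(X_0,Y_0)=1$, and bracket $[X+\lambda X_0+\mu Y_0,\,Y+\lambda'X_0+\mu'Y_0]=\mu\overline C(Y)-\mu'\overline C(X)+B(\overline C(X),Y)X_0$ for $X,Y\in\mathfrak q$. Every solvable singular quadratic Lie algebra can be written as a double extension. A double extension is called an invertible quadratic Lie algebra if the corresponding skew-symmetric map $\overline C$ is invertible (for solvable singular algebras this does not depend on the chosen decomposition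 as a double extension). The amalgamated product of double extensions $\mathfrak g_i$ of $\mathfrak q_i$ by $\overline C_i$ ($1\le i\le k$) is the double extension of the orthogonal direct sum $\mathfrak q_1\oplus\dots\oplus\mathfrak q_k$ by $\overline C=\overline C_1\oplus\dots\oplus\overline C_k$. For $p\ge1$ and $\lambda\in\mathbb C$ let $J_p(\lambda)$ be the $p\times p$ Jordan block with $\lambda$ on the diagonal and $1$ on the superdiagonal. $\mathfrak j_{2p}(\lambda)$ is the double extension of $\mathbb C^{2p}$ (canonical basis $(E_1,\dots,E_p,F_1,\dots,F_p)$, $B(E_i,F_j)=\delta_{ij}$, $B(E_i,E_j)=B(F_i,F_j)=0$) by the skew-symmetric map with matrix $\begin{pmatrix}J_p(\lambda)&0\\0&-{}^tJ_p(\lambda)\end{pmatrix}$. *)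

theory Defs
  imports
    "Jordan_Normal_Form.Jordan_Normal_Form"
    "HOL-Library.Function_Algebras"
    "HOL-Library.Product_Plus"
begin

section \<open>Complex vector spaces\<close>

text \<open>
  A type of class \<open>complex_vector\<close> serves as an ambient space only: the spaces under
  consideration are finite-dimensional subspaces of it, so that spaces of varying dimension
  can share one type. Maps and forms matter only on the carriers.
\<close>

class complex_vector = ab_group_add +
  fixes scaleC :: "complex \<Rightarrow> 'a \<Rightarrow> 'a"  (infixr \<open>*\<^sub>C\<close> 75)
  assumes scaleC_add_right: "c *\<^sub>C (x + y) = c *\<^sub>C x + c *\<^sub>C y"
    and scaleC_add_left: "(c + d) *\<^sub>C x = c *\<^sub>C x + d *\<^sub>C x"
    and scaleC_scaleC: "c *\<^sub>C d *\<^sub>C x = (c * d) *\<^sub>C x"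
    and scaleC_one: "1 *\<^sub>C x = x"

interpretation complex_vector: vector_space "scaleC :: complex \<Rightarrow> 'a \<Rightarrow> 'a::complex_vector"
  by unfold_locales (rule scaleC_add_right scaleC_add_left scaleC_scaleC scaleC_one)+

instantiation complex :: complex_vector
begin

definition scaleC_complex_def: "c *\<^sub>C (z::complex) = c * z"

instance by standard (simp_all add: scaleC_complex_def algebra_simps)

end

instantiation prod :: (complex_vector, complex_vector) complex_vector
begin

definition scaleC_prod_def: "c *\<^sub>C p = (c *\<^sub>C fst p, c *\<^sub>C snd p)"

instance
  by standard (simp_all add: scaleC_prod_def scaleC_add_right scaleC_add_left
      scaleC_scaleC scaleC_one)

end

instantiation "fun" :: (type, complex_vector) complex_vector
begin

definition scaleC_fun_def: "c *\<^sub>C f = (\<lambda>x. c *\<^sub>C f x)"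

instance
  by standard (simp_all add: scaleC_fun_def fun_eq_iff scaleC_add_right scaleC_add_left
      scaleC_scaleC scaleC_one)

end

definition linear_on :: "'a::complex_vector set \<Rightarrow> ('a \<Rightarrow> 'b::complex_vector) \<Rightarrow> bool" where
  "linear_on V f \<longleftrightarrow>
     (\<forall>x\<in>V. \<forall>y\<in>V. f (x + y) = f x + f y) \<and> (\<forall>c. \<forall>x\<in>V. f (c *\<^sub>C x) = c *\<^sub>C f x)"

definition bilinear_on ::
    "'a::complex_vector set \<Rightarrow> ('a \<Rightarrow> 'a \<Rightarrow> 'b::complex_vector) \<Rightarrow> bool" where
  "bilinear_on V f \<longleftrightarrow>
     (\<forall>x\<in>V. linear_on V (\<lambda>y. f x y)) \<and> (\<forall>y\<in>V. linear_on V (\<lambda>x. f x y))"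

section \<open>Quadratic vector spaces and quadratic Lie algebras\<close>

record 'a quadratic_space = "'a partial_object" +
  form :: "'a \<Rightarrow> 'a \<Rightarrow> complex"

record 'a quadratic_lie = "'a quadratic_space" +
  bracket :: "'a \<Rightarrow> 'a \<Rightarrow> 'a"

locale quadratic_space =
  fixes Q :: "('a::complex_vector, 'b) quadratic_space_scheme"
  assumes subspace_carrier: "complex_vector.subspace (carrier Q)"
    and finite_dimensional: "\<exists>S. finite S \<and> carrier Q \<subseteq> complex_vector.span S"
    and form_bilinear: "bilinear_on (carrier Q) (form Q)"
    and form_symmetric: "\<lbrakk>x \<in> carrier Q; y \<in> carrier Q\<rbrakk> \<Longrightarrow> form Q x y = form Q y x"
    and form_nondegenerate:
      "\<lbrakk>x \<in> carrier Q; \<And>y. y \<in> carrier Q \<Longrightarrow> form Q x y = 0\<rbrakk> \<Longrightarrow> x = 0"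

locale quadratic_lie_algebra = quadratic_space G
  for G :: "('a::complex_vector, 'b) quadratic_lie_scheme" +
  assumes bracket_closed:
      "\<lbrakk>x \<in> carrier G; y \<in> carrier G\<rbrakk> \<Longrightarrow> bracket G x y \<in> carrier G"
    and bracket_bilinear: "bilinear_on (carrier G) (bracket G)"
    and bracket_self: "x \<in> carrier G \<Longrightarrow> bracket G x x = 0"
    and jacobi: "\<lbrakk>x \<in> carrier G; y \<in> carrier G; z \<in> carrier G\<rbrakk> \<Longrightarrow>
      bracket G x (bracket G y z) + bracket G y (bracket G z x) + bracket G z (bracket G x y) = 0"
    and form_invariant: "\<lbrakk>x \<in> carrier G; y \<in> carrier G; z \<in> carrier G\<rbrakk> \<Longrightarrow>
      form G (bracket G x y) z = form G x (bracket G y z)"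

definition i_isomorphic :: "('a::complex_vector, 'c) quadratic_lie_scheme \<Rightarrow>
    ('b::complex_vector, 'd) quadratic_lie_scheme \<Rightarrow> bool" where
  "i_isomorphic G H \<longleftrightarrow> (\<exists>f. bij_betw f (carrier G) (carrier H) \<and> linear_on (carrier G) f \<and>
     (\<forall>x\<in>carrier G. \<forall>y\<in>carrier G. f (bracket G x y) = bracket H (f x) (f y)) \<and>
     (\<forall>x\<in>carrier G. \<forall>y\<in>carrier G. form H (f x) (f y) = form G x y))"

primrec derived_series :: "('a::complex_vector, 'b) quadratic_lie_scheme \<Rightarrow> nat \<Rightarrow> 'a set" where
  "derived_series G 0 = carrier G"
| "derived_series G (Suc n) = complex_vector.span
     {bracket G x y | x y. x \<in> derived_series G n \<and> y \<in> derived_series G n}"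

definition solvable_lie :: "('a::complex_vector, 'b) quadratic_lie_scheme \<Rightarrow> bool" where
  "solvable_lie G \<longleftrightarrow> (\<exists>n. derived_series G n = {0})"

definition abelian_lie :: "('a::complex_vector, 'b) quadratic_lie_scheme \<Rightarrow> bool" where
  "abelian_lie G \<longleftrightarrow> (\<forall>x\<in>carrier G. \<forall>y\<in>carrier G. bracket G x y = 0)"

definition three_form ::
    "('a::complex_vector, 'b) quadratic_lie_scheme \<Rightarrow> 'a \<Rightarrow> 'a \<Rightarrow> 'a \<Rightarrow> complex" where
  "three_form G x y z = form G (bracket G x y) z"

text \<open>
  Functionals are extended by \<open>0\<close> outside the subspace, so that distinct elements of
  \<open>dual_on V\<close> are distinct functionals on \<open>V\<close> and its dimension is that of \<open>V*\<close>.
\<close>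

definition dual_on :: "'a::complex_vector set \<Rightarrow> ('a \<Rightarrow> complex) set" where
  "dual_on V = {\<alpha>. linear_on V \<alpha> \<and> (\<forall>x. x \<notin> V \<longrightarrow> \<alpha> x = 0)}"

definition wedge_1_3 ::
    "('a \<Rightarrow> complex) \<Rightarrow> ('a \<Rightarrow> 'a \<Rightarrow> 'a \<Rightarrow> complex) \<Rightarrow> 'a \<Rightarrow> 'a \<Rightarrow> 'a \<Rightarrow> 'a \<Rightarrow> complex" where
  "wedge_1_3 \<alpha> I w x y z =
     \<alpha> w * I x y z - \<alpha> x * I w y z + \<alpha> y * I w x z - \<alpha> z * I w x y"

definition dup :: "('a::complex_vector, 'b) quadratic_lie_scheme \<Rightarrow> nat" where
  "dup G = complex_vector.dim {\<alpha> \<in> dual_on (carrier G).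
     \<forall>w\<in>carrier G. \<forall>x\<in>carrier G. \<forall>y\<in>carrier G. \<forall>z\<in>carrier G.
       wedge_1_3 \<alpha> (three_form G) w x y z = 0}"

definition singular_lie :: "('a::complex_vector, 'b) quadratic_lie_scheme \<Rightarrow> bool" where
  "singular_lie G \<longleftrightarrow> \<not> abelian_lie G \<and> dup G \<ge> 1"

section \<open>Double extensions and amalgamated products\<close>

definition skew_symmetric_map ::
    "('a::complex_vector, 'b) quadratic_space_scheme \<Rightarrow> ('a \<Rightarrow> 'a) \<Rightarrow> bool" where
  "skew_symmetric_map Q C \<longleftrightarrow> C ` carrier Q \<subseteq> carrier Q \<and> linear_on (carrier Q) C \<and>
     (\<forall>x\<in>carrier Q. \<forall>y\<in>carrier Q. form Q (C x) y = - form Q x (C y))"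

text \<open>The triple \<open>(l, m, x)\<close> stands for \<open>x + l X\<^sub>0 + m Y\<^sub>0\<close>.\<close>

definition double_extension :: "('a::complex_vector, 'b) quadratic_space_scheme \<Rightarrow>
    ('a \<Rightarrow> 'a) \<Rightarrow> (complex \<times> complex \<times> 'a) quadratic_lie" where
  "double_extension Q C =
     \<lparr>carrier = UNIV \<times> UNIV \<times> carrier Q,
      form = (\<lambda>(l, m, x) (l', m', y). l * m' + m * l' + form Q x y),
      bracket = (\<lambda>(l, m, x) (l', m', y). (form Q (C x) y, 0, m *\<^sub>C C y - m' *\<^sub>C C x))\<rparr>"

text \<open>
  Letting \<open>Q\<close> live in the ambient type of \<open>G\<close> is no restriction: a space of dimension
  at most \<open>dim G\<close> has a copy inside \<open>G\<close>. For solvable singular algebras, invertibility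
  does not depend on the decomposition, which is why the existence of one suffices.
\<close>

definition invertible_quadratic_lie ::
    "('a::complex_vector, 'b) quadratic_lie_scheme \<Rightarrow> bool" where
  "invertible_quadratic_lie G \<longleftrightarrow> (\<exists>(Q :: 'a quadratic_space) C.
     quadratic_space Q \<and> skew_symmetric_map Q C \<and> bij_betw C (carrier Q) (carrier Q) \<and>
     i_isomorphic G (double_extension Q C))"

text \<open>The sum of \<open>Q 0, ..., Q (k - 1)\<close>, as families vanishing from index \<open>k\<close> on.\<close>

definition orthogonal_sum ::
    "nat \<Rightarrow> (nat \<Rightarrow> 'a::complex_vector quadratic_space) \<Rightarrow> (nat \<Rightarrow> 'a) quadratic_space" where
  "orthogonal_sum k Q =
     \<lparr>carrier = {v. (\<forall>i<k. v i \<in> carrier (Q i)) \<and> (\<forall>i\<ge>k. v i = 0)},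
      form = (\<lambda>v w. \<Sum>i<k. form (Q i) (v i) (w i))\<rparr>"

definition sum_map ::
    "nat \<Rightarrow> (nat \<Rightarrow> 'a \<Rightarrow> 'a::complex_vector) \<Rightarrow> (nat \<Rightarrow> 'a) \<Rightarrow> nat \<Rightarrow> 'a" where
  "sum_map k C v = (\<lambda>i. if i < k then C i (v i) else 0)"

definition amalgamated_product :: "nat \<Rightarrow> (nat \<Rightarrow> 'a::complex_vector quadratic_space) \<Rightarrow>
    (nat \<Rightarrow> 'a \<Rightarrow> 'a) \<Rightarrow> (complex \<times> complex \<times> (nat \<Rightarrow> 'a)) quadratic_lie" where
  "amalgamated_product k Q C = double_extension (orthogonal_sum k Q) (sum_map k C)"

section \<open>Jordan-type Lie algebras\<close>

text \<open>
  Column vectors of length \<open>n\<close> are functions vanishing from index \<open>n\<close> on. In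
  \<open>hyperbolic_space p\<close>, the basis vectors \<open>E\<^sub>1, ..., E\<^sub>p\<close> have indices \<open>0, ..., p - 1\<close>
  and \<open>F\<^sub>1, ..., F\<^sub>p\<close> have indices \<open>p, ..., 2 p - 1\<close>.
\<close>

definition hyperbolic_space :: "nat \<Rightarrow> (nat \<Rightarrow> complex) quadratic_space" where
  "hyperbolic_space p =
     \<lparr>carrier = {v. \<forall>i\<ge>2 * p. v i = 0},
      form = (\<lambda>v w. \<Sum>i<p. v i * w (p + i) + v (p + i) * w i)\<rparr>"

definition mat_map :: "complex mat \<Rightarrow> (nat \<Rightarrow> complex) \<Rightarrow> nat \<Rightarrow> complex" where
  "mat_map A v = (\<lambda>i. if i < dim_row A then \<Sum>j<dim_col A. A $$ (i, j) * v j else 0)"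

definition jordan_skew_mat :: "nat \<Rightarrow> complex \<Rightarrow> complex mat" where
  "jordan_skew_mat p lam = four_block_mat (jordan_block p lam) (0\<^sub>m p p)
     (0\<^sub>m p p) (- transpose_mat (jordan_block p lam))"

definition jordan_type :: "nat \<Rightarrow> complex \<Rightarrow> (complex \<times> complex \<times> (nat \<Rightarrow> complex)) quadratic_lie" where
  "jordan_type p lam = double_extension (hyperbolic_space p) (mat_map (jordan_skew_mat p lam))"

end

theory Submission
  imports Defs
begin

text \<open>
  In a double extension the bracket is governed by the skew-symmetric map \<open>C\<close> alone, so the
  theorem splits into a statement on Lie algebras, that invertibility of \<open>C\<close> can be seen on
  the Lie algebra, and a statement on linear algebra, the normal form of an invertible
  skew-symmetric map up to isometry.

  For an amalgamated product of algebras of Jordan type, the centre does the first job: when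
  \<open>C\<close> is injective on a nonzero space, the centre is the line \<open>\<complex> X\<^sub>0\<close>, whereas in general
  it also contains the kernel of \<open>C\<close>. A double extension isomorphic to some \<open>j\<^sub>2\<^sub>p(\<lambda>)\<close> with
  \<open>\<lambda> \<noteq> 0\<close> therefore comes from an injective map (\<open>injective_if_isomorphic_to_injective\<close>). The
  direct sum of these maps is bijective, and pulling the orthogonal sum back along the given
  isomorphism realises it inside the original algebra
  (\<open>invertible_if_isomorphic_to_double_extension\<close>).

  Conversely, let \<open>C\<close> be invertible and skew-symmetric for a form \<open>B\<close>, and choose an eigenvalue
  \<open>\<lambda>\<close>, which is nonzero. The maps \<open>N = C - \<lambda>\<close> and \<open>M = C + \<lambda>\<close> satisfy \<open>B(N x, y) = - B(x, M y)\<close>.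
  Let \<open>p\<close> be the nilpotency index of \<open>N\<close> on its generalised kernel, attained at \<open>v\<close>. There is a \<open>w\<close>
  with \<open>M\<^sup>p w = 0\<close> that pairs with the chain \<open>v, N v, ..., N\<^sup>p\<^sup>-\<^sup>1 v\<close> to \<open>0, ..., 0, 1\<close>
  (\<open>dual_chains\<close>). Generalised eigenvectors for one nonzero eigenvalue are orthogonal to each
  other (\<open>generalised_eigenvectors_orthogonal\<close>), so the chains of \<open>v\<close> and of \<open>w\<close> span two
  isotropic spaces in duality, and on their sum \<open>C\<close> has exactly the matrix that defines
  \<open>j\<^sub>2\<^sub>p(\<lambda>)\<close> (\<open>frame_map_jordan\<close>). This sum is nondegenerate and stable under \<open>C\<close>; so is its
  orthogonal complement, which is smaller, and induction splits the whole space into such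
  summands (\<open>orthogonal_jordan_decomposition\<close>). At least one summand occurs because the algebra
  is not abelian.

  Finite dimension enters only through linear relations: any \<open>n + 1\<close> vectors are dependent.
  Applied to an orbit \<open>x, f x, f\<^sup>2 x, ...\<close> of an endomorphism, a relation yields at once eigenvectors,
  the stabilisation of kernels and images of powers, and the decomposition of Fitting.
\<close>

section \<open>Linear maps on a subspace\<close>

lemma linear_on_add: "linear_on V f \<Longrightarrow> x \<in> V \<Longrightarrow> y \<in> V \<Longrightarrow> f (x + y) = f x + f y"
  by (simp add: linear_on_def)

lemma linear_on_scale: "linear_on V f \<Longrightarrow> x \<in> V \<Longrightarrow> f (c *\<^sub>C x) = c *\<^sub>C f x"
  by (simp add: linear_on_def)

lemma linear_on_zero: "complex_vector.subspace V \<Longrightarrow> linear_on V f \<Longrightarrow> f 0 = 0"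
  by (metis complex_vector.scale_zero_left complex_vector.subspace_0 linear_on_scale)

lemma linear_on_diff:
  assumes "complex_vector.subspace V" "linear_on V f" "x \<in> V" "y \<in> V"
  shows "f (x - y) = f x - f y"
proof -
  have "f x = f ((x - y) + y)" by simp
  also have "\<dots> = f (x - y) + f y"
    using assms by (intro linear_on_add) (auto intro: complex_vector.subspace_diff)
  finally show ?thesis by simp
qed

lemma linear_on_sum:
  assumes "complex_vector.subspace V" "linear_on V f" "\<And>i. i \<in> A \<Longrightarrow> u i \<in> V"
  shows "f (\<Sum>i\<in>A. u i) = (\<Sum>i\<in>A. f (u i))"
  using assms(3)
proof (induction A rule: infinite_finite_induct)
  case (insert i A)
  have "(\<Sum>i\<in>A. u i) \<in> V" using insert assms(1) by (auto intro: complex_vector.subspace_sum)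
  then show ?case using insert assms(2) by (simp add: linear_on_add)
qed (simp_all add: linear_on_zero[OF assms(1,2)])

lemma linear_on_compose:
  assumes "linear_on V f" "f ` V \<subseteq> W" "linear_on W g"
  shows "linear_on V (\<lambda>x. g (f x))"
  using assms by (auto simp: linear_on_def image_subset_iff)

lemma linear_on_subset: "linear_on V f \<Longrightarrow> W \<subseteq> V \<Longrightarrow> linear_on W f"
  unfolding linear_on_def by blast

lemma bilinear_on_subset: "bilinear_on V f \<Longrightarrow> W \<subseteq> V \<Longrightarrow> bilinear_on W f"
  unfolding bilinear_on_def by (meson linear_on_subset subsetD)

lemma linear_on_inv_into:
  assumes V: "complex_vector.subspace V" and f: "linear_on V f" and bij: "bij_betw f V W"
  shows "linear_on W (inv_into V f)"
proof -
  let ?g = "inv_into V f"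
  have gV: "?g y \<in> V" and fg: "f (?g y) = y" if "y \<in> W" for y
    using that bij by (auto simp: bij_betw_def inv_into_into f_inv_into_f)
  have gf: "?g (f x) = x" if "x \<in> V" for x
    using that bij by (auto simp: bij_betw_def)
  have add: "?g (x + y) = ?g x + ?g y" if "x \<in> W" "y \<in> W" for x y
  proof -
    have "?g (f (?g x + ?g y)) = ?g x + ?g y"
      using that gV V by (intro gf complex_vector.subspace_add)
    then show ?thesis using that gV fg f by (simp add: linear_on_add)
  qed
  have scale: "?g (c *\<^sub>C x) = c *\<^sub>C ?g x" if "x \<in> W" for c x
  proof -
    have "?g (f (c *\<^sub>C ?g x)) = c *\<^sub>C ?g x"
      using that gV V by (intro gf complex_vector.subspace_scale)
    then show ?thesis using that gV fg f by (simp add: linear_on_scale)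
  qed
  show ?thesis using add scale by (simp add: linear_on_def)
qed

section \<open>Linear relations and endomorphisms\<close>

text \<open>
  Stating the bound through relations between families, instead of through bases, makes it
  apply directly to orbits and pass to a complement by adding one vector to a family.
\<close>

definition dim_at_most :: "'a::complex_vector set \<Rightarrow> nat \<Rightarrow> bool" where
  "dim_at_most V n \<longleftrightarrow> (\<forall>u. (\<forall>i\<le>n. u i \<in> V) \<longrightarrow>
     (\<exists>a. (\<exists>i\<le>n. a i \<noteq> 0) \<and> (\<Sum>i\<le>n. a i *\<^sub>C u i) = 0))"

lemma dim_at_most_card:
  fixes S :: "'a::complex_vector set"
  assumes S: "finite S" and V: "V \<subseteq> complex_vector.span S"
  shows "dim_at_most V (card S)"
  unfolding dim_at_most_def
proof (intro allI impI)
  fix u :: "nat \<Rightarrow> 'a" assume u: "\<forall>i\<le>card S. u i \<in> V"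
  let ?n = "card S"
  show "\<exists>a. (\<exists>i\<le>?n. a i \<noteq> 0) \<and> (\<Sum>i\<le>?n. a i *\<^sub>C u i) = 0"
  proof (cases "inj_on u {..?n}")
    case inj: True
    have "complex_vector.dependent (u ` {..?n})"
    proof (rule ccontr)
      assume "\<not> complex_vector.dependent (u ` {..?n})"
      then have "card (u ` {..?n}) \<le> ?n"
        using complex_vector.independent_span_bound[OF S] u V by blast
      then show False by (simp add: card_image[OF inj])
    qed
    then obtain c where c: "\<exists>v\<in>u ` {..?n}. c v \<noteq> 0" "(\<Sum>v\<in>u ` {..?n}. c v *\<^sub>C v) = 0"
      using complex_vector.dependent_finite[of "u ` {..?n}"] by auto
    then show ?thesis
      by (intro exI[of _ "c \<circ> u"]) (auto simp: sum.reindex[OF inj])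
  next
    case False
    then obtain i j where ij: "i \<le> ?n" "j \<le> ?n" "i \<noteq> j" "u i = u j" by (auto simp: inj_on_def)
    let ?a = "\<lambda>l. (if l = i then 1 else 0) - (if l = j then 1 else 0 :: complex)"
    have "(\<Sum>l\<le>?n. ?a l *\<^sub>C u l)
        = (\<Sum>l\<le>?n. (if l = i then u l else 0)) - (\<Sum>l\<le>?n. (if l = j then u l else 0))"
      unfolding sum_subtractf[symmetric]
      by (intro sum.cong) (auto simp: complex_vector.scale_left_diff_distrib)
    also have "\<dots> = 0" using ij by simp
    finally show ?thesis using ij by (intro exI[of _ ?a]) auto
  qed
qed

locale endomorphism =
  fixes V :: "'a::complex_vector set" and f :: "'a \<Rightarrow> 'a"
  assumes subspace: "complex_vector.subspace V"
    and linear: "linear_on V f"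
    and maps: "x \<in> V \<Longrightarrow> f x \<in> V"
begin

lemma pow_maps: "x \<in> V \<Longrightarrow> (f ^^ k) x \<in> V"
  by (induction k) (auto simp: maps)

lemma pow_linear: "linear_on V (f ^^ k)"
proof (induction k)
  case (Suc k)
  then show ?case using linear_on_compose[OF Suc _ linear] pow_maps by (auto simp: o_def)
qed (simp add: linear_on_def)

lemma pow_zero [simp]: "(f ^^ k) 0 = 0"
  by (rule linear_on_zero[OF subspace pow_linear])

lemma pow_add: "x \<in> V \<Longrightarrow> y \<in> V \<Longrightarrow> (f ^^ k) (x + y) = (f ^^ k) x + (f ^^ k) y"
  by (rule linear_on_add[OF pow_linear])

lemma pow_diff: "x \<in> V \<Longrightarrow> y \<in> V \<Longrightarrow> (f ^^ k) (x - y) = (f ^^ k) x - (f ^^ k) y"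
  by (rule linear_on_diff[OF subspace pow_linear])

lemma pow_scale: "x \<in> V \<Longrightarrow> (f ^^ k) (c *\<^sub>C x) = c *\<^sub>C (f ^^ k) x"
  by (rule linear_on_scale[OF pow_linear])

lemma pow_eq_0_mono: "(f ^^ k) x = 0 \<Longrightarrow> k \<le> l \<Longrightarrow> (f ^^ l) x = 0"
  by (metis funpow_add le_add_diff_inverse2 o_apply pow_zero)

text \<open>
  A nontrivial relation between \<open>x, f x, ..., f\<^sup>n x\<close>, shifted so that its lowest term becomes
  a multiple of \<open>f\<^sup>n x\<close>, writes this vector as an element of the image of \<open>f\<^sup>n\<^sup>+\<^sup>1\<close>. The other terms
  vanish when \<open>f\<^sup>n\<^sup>+\<^sup>1 x = 0\<close>, which gives the last claim.
\<close>

lemma pow_relation: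
  assumes "dim_at_most V n" and x: "x \<in> V"
  obtains z where "z \<in> V" "(f ^^ n) x = (f ^^ Suc n) z" "(f ^^ Suc n) x = 0 \<Longrightarrow> (f ^^ n) x = 0"
proof -
  obtain a where nz: "\<exists>i\<le>n. a i \<noteq> 0" and rel: "(\<Sum>i\<le>n. a i *\<^sub>C (f ^^ i) x) = 0"
    using assms pow_maps unfolding dim_at_most_def by meson
  define i0 where "i0 = (LEAST i. i \<le> n \<and> a i \<noteq> 0)"
  have i0: "i0 \<le> n" "a i0 \<noteq> 0"
    using LeastI_ex[of "\<lambda>i. i \<le> n \<and> a i \<noteq> 0"] nz unfolding i0_def by auto
  have low: "a i = 0" if "i < i0" for i
    using not_less_Least[of i "\<lambda>i. i \<le> n \<and> a i \<noteq> 0"] that i0(1) unfolding i0_def by auto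
  let ?z = "\<Sum>i\<in>{i0<..n}. (- a i / a i0) *\<^sub>C (f ^^ (i - Suc i0)) x"
  have zV: "?z \<in> V"
    using subspace pow_maps x
    by (intro complex_vector.subspace_sum complex_vector.subspace_scale) auto
  have "(\<Sum>i\<le>n. a i *\<^sub>C (f ^^ i) x) = (\<Sum>i\<in>insert i0 {i0<..n}. a i *\<^sub>C (f ^^ i) x)"
    using i0(1) low by (intro sum.mono_neutral_right) (auto simp: not_less)
  with rel have rel': "a i0 *\<^sub>C (f ^^ i0) x + (\<Sum>i\<in>{i0<..n}. a i *\<^sub>C (f ^^ i) x) = 0"
    by simp
  \<comment> \<open>Applying a power of the map moves the lowest term of the relation to exponent \<open>n\<close>.\<close>
  have shift: "(f ^^ (n - i0)) ((f ^^ i) x) = (f ^^ Suc n) ((f ^^ (i - Suc i0)) x)"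
    if "i \<in> {i0<..n}" for i
  proof -
    have "n - i0 + i = Suc n + (i - Suc i0)" using that i0(1) by auto
    then show ?thesis by (metis funpow_add o_apply)
  qed
  have "(f ^^ (n - i0)) (a i0 *\<^sub>C (f ^^ i0) x + (\<Sum>i\<in>{i0<..n}. a i *\<^sub>C (f ^^ i) x))
      = a i0 *\<^sub>C (f ^^ n) x + (\<Sum>i\<in>{i0<..n}. a i *\<^sub>C (f ^^ (n - i0)) ((f ^^ i) x))"
  proof -
    have "(\<Sum>i\<in>{i0<..n}. a i *\<^sub>C (f ^^ i) x) \<in> V"
      using subspace pow_maps x
      by (intro complex_vector.subspace_sum complex_vector.subspace_scale) auto
    moreover have "(f ^^ (n - i0)) ((f ^^ i0) x) = (f ^^ n) x"
      using i0(1) by (metis funpow_add le_add_diff_inverse2 o_apply)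
    ultimately show ?thesis
      using pow_maps x subspace
      by (simp add: pow_add pow_scale complex_vector.subspace_scale
          linear_on_sum[OF subspace pow_linear])
  qed
  then have eq: "a i0 *\<^sub>C (f ^^ n) x
      + (\<Sum>i\<in>{i0<..n}. a i *\<^sub>C (f ^^ Suc n) ((f ^^ (i - Suc i0)) x)) = 0"
    using rel' shift by simp
  have sc: "(f ^^ n) x = - (inverse (a i0) *\<^sub>C
      (\<Sum>i\<in>{i0<..n}. a i *\<^sub>C (f ^^ Suc n) ((f ^^ (i - Suc i0)) x)))"
  proof -
    have "inverse (a i0) *\<^sub>C (a i0 *\<^sub>C (f ^^ n) x
      + (\<Sum>i\<in>{i0<..n}. a i *\<^sub>C (f ^^ Suc n) ((f ^^ (i - Suc i0)) x))) = 0"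
      using eq by simp
    then show ?thesis
      using i0(2) by (simp add: complex_vector.scale_right_distrib eq_neg_iff_add_eq_0 del: funpow.simps)
  qed
  have "(f ^^ Suc n) ?z
      = (\<Sum>i\<in>{i0<..n}. (- a i / a i0) *\<^sub>C (f ^^ Suc n) ((f ^^ (i - Suc i0)) x))"
    by (subst linear_on_sum[OF subspace pow_linear], rule complex_vector.subspace_scale[OF subspace],
        rule pow_maps[OF x]) (simp only: pow_scale[OF pow_maps[OF x]])
  also have "\<dots> = (f ^^ n) x"
    unfolding sc complex_vector.scale_sum_right sum_negf[symmetric]
    by (intro sum.cong) (simp_all add: divide_inverse mult.commute del: funpow.simps)
  finally have 1: "(f ^^ n) x = (f ^^ Suc n) ?z" by simp
  have 2: "(f ^^ n) x = 0" if "(f ^^ Suc n) x = 0"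
  proof -
    have "(f ^^ Suc n) ((f ^^ k) x) = 0" for k
      using that by (metis add.commute funpow_add o_apply pow_zero)
    then show ?thesis using sc by (simp del: funpow.simps)
  qed
  show thesis using that[OF zV 1 2] by blast
qed

lemma kernel_stabilises:
  assumes n: "dim_at_most V n" and x: "x \<in> V" and "(f ^^ k) x = 0"
  shows "(f ^^ n) x = 0"
proof -
  have "(f ^^ (n + j)) x = 0 \<Longrightarrow> (f ^^ n) x = 0" for j
  proof (induction j)
    case (Suc j)
    have "(f ^^ Suc n) ((f ^^ j) x) = 0"
      using Suc.prems by (metis add_Suc add_Suc_right funpow_add o_apply)
    then have "(f ^^ n) ((f ^^ j) x) = 0"
      using pow_relation[OF n pow_maps[OF x, of j]] by metis
    then show ?case using Suc.IH by (metis funpow_add o_apply)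
  qed simp
  then show ?thesis using pow_eq_0_mono[OF assms(3), of "n + k"] by simp
qed

text \<open>
  The images of \<open>f\<^sup>n\<close> and \<open>f\<^sup>2\<^sup>n\<close> agree, so \<open>f\<^sup>n x = f\<^sup>2\<^sup>n z\<close> for some \<open>z\<close>, and then
  \<open>x - f\<^sup>n z\<close> lies in the kernel of \<open>f\<^sup>n\<close>.
\<close>

lemma fitting_decomposition:
  assumes n: "dim_at_most V n" and x: "x \<in> V"
  obtains y z where "y \<in> V" "z \<in> V" "x = y + (f ^^ n) z" "(f ^^ n) y = 0"
proof -
  have "\<exists>z\<in>V. (f ^^ n) x = (f ^^ (n + j)) z" for j
  proof (induction j)
    case (Suc j)
    then obtain z where z: "z \<in> V" "(f ^^ n) x = (f ^^ (n + j)) z" by blast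
    obtain t where t: "t \<in> V" "(f ^^ n) z = (f ^^ Suc n) t"
      using pow_relation[OF n z(1)] by metis
    have "(f ^^ (n + j)) z = (f ^^ j) ((f ^^ n) z)" by (metis add.commute funpow_add o_apply)
    also have "\<dots> = (f ^^ (n + Suc j)) t"
      unfolding t by (metis add.commute add_Suc_shift funpow_add o_apply)
    finally show ?case using z t by auto
  qed (use x in auto)
  then obtain z where z: "z \<in> V" "(f ^^ n) x = (f ^^ (n + n)) z" by blast
  show thesis
  proof (rule that)
    show "x - (f ^^ n) z \<in> V" using x z pow_maps subspace by (auto intro: complex_vector.subspace_diff)
    show "(f ^^ n) (x - (f ^^ n) z) = 0"
      using x z pow_maps by (simp add: pow_diff funpow_add)
  qed (use z in auto)
qed

lemma injective_imp_bijective: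
  assumes n: "dim_at_most V n" and inj: "\<And>x. x \<in> V \<Longrightarrow> f x = 0 \<Longrightarrow> x = 0"
  shows "bij_betw f V V"
proof -
  have "inj_on f V"
  proof (rule inj_onI)
    fix x y assume xy: "x \<in> V" "y \<in> V" "f x = f y"
    then have "f (x - y) = 0" by (simp add: linear_on_diff[OF subspace linear])
    then show "x = y" using inj[of "x - y"] complex_vector.subspace_diff[OF subspace] xy by simp
  qed
  moreover have "x \<in> f ` V" if x: "x \<in> V" for x
  proof -
    obtain z where z: "z \<in> V" "(f ^^ n) x = (f ^^ Suc n) z" using pow_relation[OF n x] by metis
    have cancel: "(f ^^ k) y = 0 \<Longrightarrow> y \<in> V \<Longrightarrow> y = 0" for k y
      by (induction k) (auto simp: inj pow_maps)
    have "(f ^^ n) (x - f z) = 0" using x z maps by (simp add: pow_diff funpow_swap1)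
    moreover have "x - f z \<in> V" using x z maps complex_vector.subspace_diff[OF subspace] by blast
    ultimately have "x - f z = 0" by (rule cancel)
    then show ?thesis using z by auto
  qed
  ultimately show ?thesis using maps by (auto simp: bij_betw_def)
qed

lemma endomorphism_minus_scalar: "endomorphism V (\<lambda>x. f x - c *\<^sub>C x)"
  using subspace linear maps
  by unfold_locales (auto simp: linear_on_def complex_vector.scale_right_diff_distrib
      complex_vector.scale_right_distrib complex_vector.scale_left_commute
      intro!: complex_vector.subspace_diff complex_vector.subspace_scale)

text \<open>
  Split off a root \<open>z\<close> of the annihilating polynomial, \<open>P = (X - z) R\<close>: either \<open>x\<close> is an
  eigenvector for \<open>z\<close>, or \<open>f x - z x\<close> is a nonzero vector annihilated by \<open>R\<close>.
\<close>

lemma eigenvector_if_annihilated: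
  assumes "P \<noteq> 0" "degree P \<le> m" "x \<in> V" "x \<noteq> 0" "(\<Sum>i\<le>m. poly.coeff P i *\<^sub>C (f ^^ i) x) = 0"
  shows "\<exists>c. \<exists>y\<in>V. y \<noteq> 0 \<and> f y = c *\<^sub>C y"
  using assms
proof (induction m arbitrary: P x)
  case 0
  then show ?case using leading_coeff_neq_0[of P] by auto
next
  case (Suc m)
  show ?case
  proof (cases "degree P \<le> m")
    case True
    then have "poly.coeff P (Suc m) = 0" by (simp add: coeff_eq_0)
    then show ?thesis using Suc.IH[OF Suc.prems(1) True Suc.prems(3,4)] Suc.prems(5) by simp
  next
    case False
    then have "degree P = Suc m" using Suc.prems by simp
    then obtain z where "poly P z = 0"
      using fundamental_theorem_of_algebra[of P] constant_degree[of P] by auto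
    then obtain R where R: "P = [:-z, 1:] * R" by (auto simp: poly_eq_0_iff_dvd dvd_def)
    have Rnz: "R \<noteq> 0" using Suc.prems R by auto
    have "degree P = Suc (degree R)" unfolding R using Rnz by (subst degree_mult_eq) auto
    then have dR: "degree R \<le> m" using Suc.prems by simp
    define y where "y = f x - z *\<^sub>C x"
    have y: "y \<in> V" unfolding y_def using Suc.prems maps subspace
      by (auto intro: complex_vector.subspace_diff complex_vector.subspace_scale)
    show ?thesis
    proof (cases "y = 0")
      case True
      then show ?thesis using Suc.prems unfolding y_def by auto
    next
      case False
      have summand: "poly.coeff R i *\<^sub>C (f ^^ i) y 
          = poly.coeff R i *\<^sub>C (f ^^ Suc i) x - (z * poly.coeff R i) *\<^sub>C (f ^^ i) x" for i
        unfolding y_def using Suc.prems(3) maps subspace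
        by (simp add: pow_diff pow_scale complex_vector.subspace_scale funpow_swap1
            complex_vector.scale_right_diff_distrib mult.commute)
      have "(\<Sum>i\<le>m. poly.coeff R i *\<^sub>C (f ^^ i) y)
          = (\<Sum>i\<le>m. poly.coeff R i *\<^sub>C (f ^^ Suc i) x) - (\<Sum>i\<le>m. (z * poly.coeff R i) *\<^sub>C (f ^^ i) x)"
        by (simp only: summand sum_subtractf)
      also have "(\<Sum>i\<le>m. poly.coeff R i *\<^sub>C (f ^^ Suc i) x)
          = (\<Sum>i\<le>Suc m. poly.coeff (pCons 0 R) i *\<^sub>C (f ^^ i) x)"
        by (subst sum.atMost_Suc_shift) (simp del: funpow.simps sum.atMost_Suc)
      also have "(\<Sum>i\<le>m. (z * poly.coeff R i) *\<^sub>C (f ^^ i) x)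
          = (\<Sum>i\<le>Suc m. poly.coeff (Polynomial.smult z R) i *\<^sub>C (f ^^ i) x)"
        using dR by (simp add: coeff_eq_0)
      also have "(\<Sum>i\<le>Suc m. poly.coeff (pCons 0 R) i *\<^sub>C (f ^^ i) x) - \<dots>
          = (\<Sum>i\<le>Suc m. poly.coeff P i *\<^sub>C (f ^^ i) x)"
      proof -
        have "poly.coeff P i = poly.coeff (pCons 0 R) i - poly.coeff (Polynomial.smult z R) i" for i
          unfolding R by (simp)
        then show ?thesis
          by (simp only: complex_vector.scale_left_diff_distrib sum_subtractf)
      qed
      finally show ?thesis using Suc.IH[OF Rnz dR y False] Suc.prems(5) by simp
    qed
  qed
qed

lemma eigenvector_exists:
  assumes n: "dim_at_most V n" and x: "x \<in> V" "x \<noteq> 0"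
  obtains c y where "y \<in> V" "y \<noteq> 0" "f y = c *\<^sub>C y"
proof -
  obtain a where nz: "\<exists>i\<le>n. a i \<noteq> 0" and rel: "(\<Sum>i\<le>n. a i *\<^sub>C (f ^^ i) x) = 0"
    using n pow_maps[OF x(1)] unfolding dim_at_most_def by meson
  let ?P = "\<Sum>i\<le>n. monom (a i) i"
  have c: "poly.coeff ?P i = (if i \<le> n then a i else 0)" for i
    by (simp add: coeff_sum)
  have "?P \<noteq> 0" using nz c by (metis coeff_0)
  moreover have "degree ?P \<le> n" using c by (intro degree_le) simp
  ultimately show thesis
    using eigenvector_if_annihilated[of ?P n x] x rel that by (auto simp: c)
qed

end

section \<open>Double extensions of isometric pairs\<close>

text \<open>
  An isometry that carries one map to the other extends, by the identity on \<open>X\<^sub>0\<close> and \<open>Y\<^sub>0\<close>,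
  to an i-isomorphism of the double extensions.
\<close>

definition intertwining_isometry :: "('a::complex_vector, 'c) quadratic_space_scheme \<Rightarrow> ('a \<Rightarrow> 'a) \<Rightarrow>
    ('b::complex_vector, 'd) quadratic_space_scheme \<Rightarrow> ('b \<Rightarrow> 'b) \<Rightarrow> ('a \<Rightarrow> 'b) \<Rightarrow> bool" where
  "intertwining_isometry Q C Q' C' h \<longleftrightarrow> bij_betw h (carrier Q) (carrier Q') \<and> linear_on (carrier Q) h \<and>
     (\<forall>x\<in>carrier Q. \<forall>y\<in>carrier Q. form Q' (h x) (h y) = form Q x y) \<and>
     (\<forall>x\<in>carrier Q. C x \<in> carrier Q \<and> h (C x) = C' (h x))"

lemma intertwining_isometry_inv:
  assumes sub: "complex_vector.subspace (carrier Q)" and h: "intertwining_isometry Q C Q' C' h"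
  shows "intertwining_isometry Q' C' Q C (inv_into (carrier Q) h)"
proof -
  let ?g = "inv_into (carrier Q) h"
  have bij: "bij_betw h (carrier Q) (carrier Q')" using h by (simp add: intertwining_isometry_def)
  have gQ: "?g y \<in> carrier Q" and hg: "h (?g y) = y" if "y \<in> carrier Q'" for y
    using that bij by (auto simp: bij_betw_def inv_into_into f_inv_into_f)
  have gh: "?g (h x) = x" if "x \<in> carrier Q" for x
    using that bij by (auto simp: bij_betw_def)
  have C': "C' y = h (C (?g y))" "C (?g y) \<in> carrier Q" if "y \<in> carrier Q'" for y
    using h gQ[OF that] hg[OF that] by (auto simp: intertwining_isometry_def)
  have "C' y \<in> carrier Q'" "?g (C' y) = C (?g y)" if "y \<in> carrier Q'" for y
    using C'[OF that] gh bij by (auto simp: bij_betw_def)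
  moreover have "form Q (?g x) (?g y) = form Q' x y" if "x \<in> carrier Q'" "y \<in> carrier Q'" for x y
    using h gQ[OF that(1)] gQ[OF that(2)] hg[OF that(1)] hg[OF that(2)]
    unfolding intertwining_isometry_def by metis
  ultimately show ?thesis
    using bij_betw_inv_into[OF bij] linear_on_inv_into[OF sub _ bij] h
    by (simp add: intertwining_isometry_def)
qed

lemma double_extension_simps [simp]:
  "carrier (double_extension Q C) = UNIV \<times> UNIV \<times> carrier Q"
  "form (double_extension Q C) (l, m, x) (l', m', y) = l * m' + m * l' + form Q x y"
  "bracket (double_extension Q C) (l, m, x) (l', m', y)
     = (form Q (C x) y, 0, m *\<^sub>C C y - m' *\<^sub>C C x)"
  by (simp_all add: double_extension_def)

lemma scaleC_prod_simps [simp]: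
  fixes x :: "'a::complex_vector" and y :: "'b::complex_vector"
  shows "c *\<^sub>C (x, y) = (c *\<^sub>C x, c *\<^sub>C y)"
  by (simp add: scaleC_prod_def)

lemma double_extension_intertwining:
  assumes sub: "complex_vector.subspace (carrier Q)" and h: "intertwining_isometry Q C Q' C' h"
  shows "i_isomorphic (double_extension Q C) (double_extension Q' C')"
proof -
  have bij: "bij_betw h (carrier Q) (carrier Q')" and lin: "linear_on (carrier Q) h"
    and iso: "\<And>x y. x \<in> carrier Q \<Longrightarrow> y \<in> carrier Q \<Longrightarrow> form Q' (h x) (h y) = form Q x y"
    and C: "\<And>x. x \<in> carrier Q \<Longrightarrow> C x \<in> carrier Q" "\<And>x. x \<in> carrier Q \<Longrightarrow> C' (h x) = h (C x)"
    using h by (auto simp: intertwining_isometry_def)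
  let ?f = "\<lambda>(l :: complex, m :: complex, x). (l, m, h x)"
  have f: "?f = map_prod id (map_prod id h)" by (auto simp: fun_eq_iff)
  have "bij_betw ?f (carrier (double_extension Q C)) (carrier (double_extension Q' C'))"
    unfolding f double_extension_simps by (intro bij_betw_map_prod bij bij_betw_id)
  moreover have "linear_on (carrier (double_extension Q C)) ?f"
    using lin by (auto simp: linear_on_def)
  moreover have "?f (bracket (double_extension Q C) u v)
      = bracket (double_extension Q' C') (?f u) (?f v)"
    if "u \<in> carrier (double_extension Q C)" "v \<in> carrier (double_extension Q C)" for u v
  proof -
    have "h (m *\<^sub>C C y - m' *\<^sub>C C x) = m *\<^sub>C h (C y) - m' *\<^sub>C h (C x)"
      if "x \<in> carrier Q" "y \<in> carrier Q" for m m' x y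
      using that sub lin C
      by (simp add: linear_on_diff linear_on_scale complex_vector.subspace_scale)
    then show ?thesis using that C iso by (auto split: prod.splits)
  qed
  moreover have "form (double_extension Q' C') (?f u) (?f v) = form (double_extension Q C) u v"
    if "u \<in> carrier (double_extension Q C)" "v \<in> carrier (double_extension Q C)" for u v
    using that iso by (auto split: prod.splits)
  ultimately show ?thesis unfolding i_isomorphic_def by blast
qed

lemma i_isomorphic_trans:
  assumes "i_isomorphic G H" "i_isomorphic H K"
  shows "i_isomorphic G K"
proof -
  obtain f where f: "bij_betw f (carrier G) (carrier H)" "linear_on (carrier G) f"
    "\<forall>x\<in>carrier G. \<forall>y\<in>carrier G. f (bracket G x y) = bracket H (f x) (f y)"
    "\<forall>x\<in>carrier G. \<forall>y\<in>carrier G. form H (f x) (f y) = form G x y"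
    using assms(1) unfolding i_isomorphic_def by blast
  obtain g where g: "bij_betw g (carrier H) (carrier K)" "linear_on (carrier H) g"
    "\<forall>x\<in>carrier H. \<forall>y\<in>carrier H. g (bracket H x y) = bracket K (g x) (g y)"
    "\<forall>x\<in>carrier H. \<forall>y\<in>carrier H. form K (g x) (g y) = form H x y"
    using assms(2) unfolding i_isomorphic_def by blast
  have fH: "f x \<in> carrier H" if "x \<in> carrier G" for x using that f(1) by (auto simp: bij_betw_def)
  show ?thesis unfolding i_isomorphic_def
  proof (intro exI[of _ "g \<circ> f"] conjI)
    show "bij_betw (g \<circ> f) (carrier G) (carrier K)" using f(1) g(1) by (rule bij_betw_trans)
    show "linear_on (carrier G) (g \<circ> f)"
      using linear_on_compose[OF f(2) _ g(2)] fH by (auto simp: o_def)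
  qed (use f(3,4) g(3,4) fH in auto)
qed

section \<open>Centres detect invertibility\<close>

lemma (in quadratic_space) form_zero_left: "y \<in> carrier Q \<Longrightarrow> form Q 0 y = 0"
  using form_bilinear linear_on_zero[OF subspace_carrier] unfolding bilinear_on_def by blast

lemma (in quadratic_space) dim_at_most_carrier: "\<exists>n. dim_at_most (carrier Q) n"
  using finite_dimensional dim_at_most_card by blast

lemma skew_endomorphism:
  assumes "quadratic_space Q" "skew_symmetric_map Q C"
  shows "endomorphism (carrier Q) C"
  using assms by (auto simp: endomorphism_def quadratic_space_def skew_symmetric_map_def)

text \<open>
  Every \<open>x\<close> in the kernel of \<open>C\<close> is central, as is \<open>X\<^sub>0\<close>. The centre of the target has
  dimension one, so \<open>x\<close> and \<open>X\<^sub>0\<close> are proportional and \<open>x\<close> vanishes.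
\<close>

lemma injective_if_isomorphic_to_injective:
  assumes Q: "quadratic_space Q" and C: "skew_symmetric_map Q C"
    and iso: "i_isomorphic (double_extension Q C) (double_extension H J)"
    and J0: "J 0 = 0" and H: "complex_vector.subspace (carrier H)"
    and inj: "\<And>x. x \<in> carrier H \<Longrightarrow> J x = 0 \<Longrightarrow> x = 0"
    and y: "y \<in> carrier H" "y \<noteq> 0"
    and x: "x \<in> carrier Q" "C x = 0"
  shows "x = 0"
proof -
  let ?D = "double_extension Q C" and ?E = "double_extension H J"
  interpret quadratic_space Q by fact
  obtain f where bij: "bij_betw f (carrier ?D) (carrier ?E)"
    and lin: "linear_on (carrier ?D) f"
    and br: "\<forall>u\<in>carrier ?D. \<forall>v\<in>carrier ?D. f (bracket ?D u v) = bracket ?E (f u) (f v)"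
    using iso unfolding i_isomorphic_def by blast
  have H0: "0 \<in> carrier H" using H by (rule complex_vector.subspace_0)
  have Q0: "0 \<in> carrier Q" using subspace_carrier by (rule complex_vector.subspace_0)
  have C0: "C 0 = 0"
    using C linear_on_zero[OF subspace_carrier] by (auto simp: skew_symmetric_map_def)
  have subD: "complex_vector.subspace (carrier ?D)"
    using subspace_carrier by (auto simp: complex_vector.subspace_def zero_prod_def)
  \<comment> \<open>The centre of the target is the line spanned by its vector \<open>X\<^sub>0\<close>.\<close>
  have central: "\<exists>a. f u = (a, 0, 0)" if u: "u \<in> carrier ?D"
    and cu: "\<And>v. v \<in> carrier ?D \<Longrightarrow> bracket ?D u v = 0" for u
  proof -
    obtain a m z where fu: "f u = (a, m, z)" by (metis prod_cases3)
    have "f u \<in> carrier ?E" using bij u by (rule bij_betw_apply)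
    then have z: "z \<in> carrier H" using fu by simp
    have cE: "bracket ?E (a, m, z) v = 0" if "v \<in> carrier ?E" for v
    proof -
      have "v \<in> f ` carrier ?D" using that bij unfolding bij_betw_def by blast
      then obtain v' where v': "v' \<in> carrier ?D" "v = f v'" by blast
      have "f (bracket ?D u v') = bracket ?E (f u) (f v')" using br u v'(1) by blast
      then show ?thesis using fu v' cu[OF v'(1)] linear_on_zero[OF subD lin] by metis
    qed
    have "J z = 0" using cE[of "(0, 1, 0)"] H0 J0 by (simp add: zero_prod_def)
    then have z0: "z = 0" using inj z by blast
    have "m *\<^sub>C J y = 0" using cE[of "(0, 0, y)"] y(1) by (simp add: zero_prod_def)
    then have "m = 0" using inj y by auto
    then show ?thesis using fu z0 by simp
  qed
  obtain a where a: "f (1, 0, 0) = (a, 0, 0)"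
    using central[of "(1, 0, 0)"] Q0 C0 form_zero_left by (auto simp: zero_prod_def)
  obtain b where b: "f (0, 0, x) = (b, 0, 0)"
    using central[of "(0, 0, x)"] x form_zero_left by (auto simp: zero_prod_def)
  have "f (a *\<^sub>C (0, 0, x)) = f (b *\<^sub>C (1, 0, 0))"
    using a b linear_on_scale[OF lin, of "(0, 0, x)" a] linear_on_scale[OF lin, of "(1, 0, 0)" b] x Q0
    by (simp add: scaleC_complex_def mult.commute)
  moreover have "a *\<^sub>C (0, 0, x) \<in> carrier ?D" "b *\<^sub>C (1, 0, 0) \<in> carrier ?D"
    using x Q0 subspace_carrier by (auto intro: complex_vector.subspace_scale)
  ultimately have "a *\<^sub>C (0, 0, x) = b *\<^sub>C (1 :: complex, 0 :: complex, 0)"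
    using bij by (auto simp: bij_betw_def dest: inj_onD)
  then have "b = 0" "a *\<^sub>C x = 0" by (auto simp: scaleC_complex_def)
  moreover have "a \<noteq> 0"
  proof
    assume "a = 0"
    then have "f (1, 0, 0) = f 0" using a linear_on_zero[OF subD lin] by (simp add: zero_prod_def)
    then have "(1 :: complex, 0 :: complex, 0) = (0 :: complex \<times> complex \<times> 'a)"
      using bij Q0 by (intro inj_onD[of f "carrier ?D"]) (auto simp: bij_betw_def zero_prod_def)
    then show False by (simp add: zero_prod_def)
  qed
  ultimately show ?thesis by simp
qed

section \<open>The skew-symmetric map of a Jordan-type algebra\<close>

lemma jordan_skew_map_apply:
  assumes "i < p"
  shows "mat_map (jordan_skew_mat p lam) v i = lam * v i + (if Suc i < p then v (Suc i) else 0)"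
    and "mat_map (jordan_skew_mat p lam) v (p + i)
      = - (lam * v (p + i)) - (if i = 0 then 0 else v (p + i - 1))"
proof -
  let ?A = "jordan_skew_mat p lam"
  have dims: "dim_row ?A = p + p" "dim_col ?A = p + p" by (simp_all add: jordan_skew_mat_def)
  have split: "(\<Sum>j<p + p. g j) = (\<Sum>j<p. g j) + (\<Sum>j<p. g (p + j))" for g :: "nat \<Rightarrow> complex"
    by (simp add: lessThan_atLeast0 sum.atLeastLessThan_concat[of 0 p "p + p" g, symmetric]
        sum.shift_bounds_nat_ivl[of g 0 p p, simplified] add.commute)
  have up: "?A $$ (i, j) = (if i = j then lam else if Suc i = j then 1 else 0)"
    "?A $$ (i, p + j) = 0" if "j < p" for j
    using assms that by (auto simp: jordan_skew_mat_def)
  have low: "?A $$ (p + i, p + j) = - (if i = j then lam else if Suc j = i then 1 else 0)"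
    "?A $$ (p + i, j) = 0" if "j < p" for j
    using assms that by (auto simp: jordan_skew_mat_def)
  have "mat_map ?A v i = (\<Sum>j<p. (if i = j then lam * v j else 0) + (if Suc i = j then v j else 0))"
    using assms unfolding mat_map_def dims split
    by (simp add: up) (intro sum.cong; auto)
  also have "\<dots> = lam * v i + (if Suc i < p then v (Suc i) else 0)"
    using assms by (simp add: sum.distrib)
  finally show "mat_map ?A v i = lam * v i + (if Suc i < p then v (Suc i) else 0)" .
  have "mat_map ?A v (p + i)
      = (\<Sum>j<p. - (if i = j then lam * v (p + j) else 0) - (if Suc j = i then v (p + j) else 0))"
    using assms unfolding mat_map_def dims split
    by (simp add: low) (intro sum.cong; auto)
  also have "\<dots> = - (lam * v (p + i)) - (\<Sum>j<p. if Suc j = i then v (p + j) else 0)"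
    using assms by (simp add: sum_subtractf sum_negf)
  also have "(\<Sum>j<p. if Suc j = i then v (p + j) else 0) = (if i = 0 then 0 else v (p + i - 1))"
    using assms by (cases i) auto
  finally show "mat_map ?A v (p + i)
      = - (lam * v (p + i)) - (if i = 0 then 0 else v (p + i - 1))" .
qed

lemma jordan_skew_map_outside: "2 * p \<le> i \<Longrightarrow> mat_map (jordan_skew_mat p lam) v i = 0"
  by (simp add: mat_map_def jordan_skew_mat_def)

lemma subspace_hyperbolic: "complex_vector.subspace (carrier (hyperbolic_space p))"
  by (auto simp: complex_vector.subspace_def hyperbolic_space_def scaleC_fun_def scaleC_complex_def)

text \<open>
  The equations \<open>J v = 0\<close> are triangular with \<open>\<plusminus> lam\<close> on the diagonal: the coordinates on
  the \<open>E\<^sub>i\<close> vanish from the last to the first, those on the \<open>F\<^sub>i\<close> from the first to the last.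
\<close>

lemma jordan_skew_map_injective:
  assumes lam: "lam \<noteq> 0" and v: "v \<in> carrier (hyperbolic_space p)"
    and zero: "mat_map (jordan_skew_mat p lam) v = 0"
  shows "v = 0"
proof -
  have up: "v i = 0" if "i < p" for i
    using that
  proof (induction "p - i" arbitrary: i rule: less_induct)
    case less
    have "Suc i < p \<Longrightarrow> v (Suc i) = 0" using less by auto
    then show ?case
      using jordan_skew_map_apply(1)[OF less.prems, of lam v] zero lam by (auto split: if_splits)
  qed
  have low: "v (p + i) = 0" if "i < p" for i
    using that
  proof (induction i)
    case 0
    then show ?case using jordan_skew_map_apply(2)[of 0 p lam v] zero lam by simp
  next
    case (Suc i)
    then show ?case using jordan_skew_map_apply(2)[of "Suc i" p lam v] zero lam by simp
  qed
  have "v i = 0" for i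
  proof (cases "i < 2 * p")
    case True
    then show ?thesis using up[of i] low[of "i - p"] by (cases "i < p") auto
  next
    case False
    then show ?thesis using v by (simp add: hyperbolic_space_def)
  qed
  then show ?thesis by (simp add: fun_eq_iff)
qed

lemma bijective_if_jordan_type:
  assumes Q: "quadratic_space Q" and C: "skew_symmetric_map Q C" and "p \<ge> 1" "lam \<noteq> 0"
    and iso: "i_isomorphic (double_extension Q C) (jordan_type p lam)"
  shows "bij_betw C (carrier Q) (carrier Q)"
proof -
  interpret quadratic_space Q by fact
  interpret endomorphism "carrier Q" C by (rule skew_endomorphism[OF Q C])
  let ?J = "mat_map (jordan_skew_mat p lam)"
  have J0: "?J 0 = 0" by (auto simp: mat_map_def fun_eq_iff)
  let ?e = "\<lambda>i::nat. if i = 0 then 1 else 0 :: complex"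
  have e: "?e \<in> carrier (hyperbolic_space p)" using \<open>p \<ge> 1\<close> by (auto simp: hyperbolic_space_def)
  have e0: "?e \<noteq> 0" by (auto simp: fun_eq_iff)
  have "x = 0" if "x \<in> carrier Q" "C x = 0" for x
    using injective_if_isomorphic_to_injective[OF Q C iso[unfolded jordan_type_def] J0
        subspace_hyperbolic jordan_skew_map_injective[OF \<open>lam \<noteq> 0\<close>] e e0 that] .
  moreover obtain n where "dim_at_most (carrier Q) n" using dim_at_most_carrier by blast
  ultimately show ?thesis by (rule injective_imp_bijective[rotated])
qed

section \<open>Quadratic subspaces\<close>

abbreviation subform ::
    "('a::complex_vector, 'b) quadratic_space_scheme \<Rightarrow> 'a set \<Rightarrow> 'a quadratic_space" where
  "subform Q W \<equiv> \<lparr>carrier = W, form = form Q\<rparr>"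

context quadratic_space
begin

lemma form_linear_left: "y \<in> carrier Q \<Longrightarrow> linear_on (carrier Q) (\<lambda>x. form Q x y)"
  and form_linear_right: "x \<in> carrier Q \<Longrightarrow> linear_on (carrier Q) (\<lambda>y. form Q x y)"
  using form_bilinear by (auto simp: bilinear_on_def)

lemmas form_add_left = linear_on_add[OF form_linear_left]
  and form_scale_left = linear_on_scale[OF form_linear_left, unfolded scaleC_complex_def]
  and form_diff_left = linear_on_diff[OF subspace_carrier form_linear_left]
  and form_sum_left = linear_on_sum[OF subspace_carrier form_linear_left]
  and form_add_right = linear_on_add[OF form_linear_right]
  and form_scale_right = linear_on_scale[OF form_linear_right, unfolded scaleC_complex_def]
  and form_diff_right = linear_on_diff[OF subspace_carrier form_linear_right]
  and form_sum_right = linear_on_sum[OF subspace_carrier form_linear_right]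

lemma form_zero_right: "x \<in> carrier Q \<Longrightarrow> form Q x 0 = 0"
  using linear_on_zero[OF subspace_carrier form_linear_right] .

lemmas carrier_add = complex_vector.subspace_add[OF subspace_carrier]
  and carrier_diff = complex_vector.subspace_diff[OF subspace_carrier]
  and carrier_scale = complex_vector.subspace_scale[OF subspace_carrier]
  and carrier_sum = complex_vector.subspace_sum[OF subspace_carrier]
  and carrier_zero = complex_vector.subspace_0[OF subspace_carrier]

lemma quadratic_subspace:
  assumes "complex_vector.subspace W" "W \<subseteq> carrier Q"
    and "\<And>x. x \<in> W \<Longrightarrow> (\<And>y. y \<in> W \<Longrightarrow> form Q x y = 0) \<Longrightarrow> x = 0"
  shows "quadratic_space (subform Q W)"
proof
  show "\<exists>S. finite S \<and> carrier (subform Q W) \<subseteq> complex_vector.span S"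
    using finite_dimensional assms(2) by auto
  show "bilinear_on (carrier (subform Q W)) (form (subform Q W))"
    using bilinear_on_subset[OF form_bilinear assms(2)] by simp
  show "form (subform Q W) x y = form (subform Q W) y x"
    if "x \<in> carrier (subform Q W)" "y \<in> carrier (subform Q W)" for x y
    using form_symmetric assms(2) that by auto
  show "x = 0" if "x \<in> carrier (subform Q W)"
    "\<And>y. y \<in> carrier (subform Q W) \<Longrightarrow> form (subform Q W) x y = 0" for x
    using assms(3) that by simp
qed (use assms in simp)

end

section \<open>Amalgamated products are invertible\<close>

lemma subspace_orthogonal_sum:
  assumes "\<And>i. i < k \<Longrightarrow> complex_vector.subspace (carrier (Q i))"
  shows "complex_vector.subspace (carrier (orthogonal_sum k Q))"
  using assms by (auto simp: complex_vector.subspace_def orthogonal_sum_def scaleC_fun_def)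

lemma skew_sum_map:
  assumes C: "\<And>i. i < k \<Longrightarrow> skew_symmetric_map (Q i) (C i)"
  shows "skew_symmetric_map (orthogonal_sum k Q) (sum_map k C)"
  unfolding skew_symmetric_map_def
proof (intro conjI ballI)
  show "sum_map k C ` carrier (orthogonal_sum k Q) \<subseteq> carrier (orthogonal_sum k Q)"
    using C by (auto simp: orthogonal_sum_def sum_map_def skew_symmetric_map_def image_subset_iff)
  have "C i (x + y) = C i x + C i y" if "i < k" "x \<in> carrier (Q i)" "y \<in> carrier (Q i)" for i x y
    using C[OF that(1)] that(2,3) by (simp add: skew_symmetric_map_def linear_on_def)
  moreover have "C i (c *\<^sub>C x) = c *\<^sub>C C i x" if "i < k" "x \<in> carrier (Q i)" for i x c
    using C[OF that(1)] that(2) by (simp add: skew_symmetric_map_def linear_on_def)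
  ultimately show "linear_on (carrier (orthogonal_sum k Q)) (sum_map k C)"
    by (simp add: linear_on_def orthogonal_sum_def sum_map_def fun_eq_iff scaleC_fun_def)
  show "form (orthogonal_sum k Q) (sum_map k C v) w = - form (orthogonal_sum k Q) v (sum_map k C w)"
    if "v \<in> carrier (orthogonal_sum k Q)" "w \<in> carrier (orthogonal_sum k Q)" for v w
  proof -
    have "form (Q i) (C i (v i)) (w i) = - form (Q i) (v i) (C i (w i))" if "i < k" for i
      using C[OF that] \<open>v \<in> _\<close> \<open>w \<in> _\<close> that
      by (simp add: skew_symmetric_map_def orthogonal_sum_def)
    then show ?thesis by (simp add: orthogonal_sum_def sum_map_def sum_negf)
  qed
qed

lemma bij_sum_map:
  assumes C: "\<And>i. i < k \<Longrightarrow> bij_betw (C i) (carrier (Q i)) (carrier (Q i))"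
  shows "bij_betw (sum_map k C) (carrier (orthogonal_sum k Q)) (carrier (orthogonal_sum k Q))"
proof (rule bij_betwI')
  fix v w assume vw: "v \<in> carrier (orthogonal_sum k Q)" "w \<in> carrier (orthogonal_sum k Q)"
  show "sum_map k C v = sum_map k C w \<longleftrightarrow> v = w"
  proof
    assume eq: "sum_map k C v = sum_map k C w"
    show "v = w"
    proof
      fix i
      show "v i = w i"
      proof (cases "i < k")
        case True
        then have "C i (v i) = C i (w i)" using fun_cong[OF eq, of i] by (simp add: sum_map_def)
        moreover have "v i \<in> carrier (Q i)" "w i \<in> carrier (Q i)"
          using vw True by (auto simp: orthogonal_sum_def)
        ultimately show ?thesis using C[OF True] by (auto simp: bij_betw_def dest: inj_onD)
      qed (use vw in \<open>auto simp: orthogonal_sum_def\<close>)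
    qed
  qed simp
next
  fix v assume "v \<in> carrier (orthogonal_sum k Q)"
  then show "sum_map k C v \<in> carrier (orthogonal_sum k Q)"
    using bij_betw_apply[OF C] by (auto simp: orthogonal_sum_def sum_map_def)
next
  fix w assume w: "w \<in> carrier (orthogonal_sum k Q)"
  define v where "v = (\<lambda>i. inv_into (carrier (Q i)) (C i) (w i))"
  have v: "v i \<in> carrier (Q i) \<and> C i (v i) = w i" if "i < k" for i
  proof -
    have "w i \<in> carrier (Q i)" using w that by (simp add: orthogonal_sum_def)
    then have "w i \<in> C i ` carrier (Q i)" using C[OF that] by (simp add: bij_betw_def)
    then show ?thesis by (simp add: v_def inv_into_into f_inv_into_f)
  qed
  let ?v = "\<lambda>i. if i < k then v i else 0"
  have "w = sum_map k C ?v"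
    using v w by (auto simp: fun_eq_iff sum_map_def orthogonal_sum_def)
  moreover have "?v \<in> carrier (orthogonal_sum k Q)" using v by (simp add: orthogonal_sum_def)
  ultimately show "\<exists>v\<in>carrier (orthogonal_sum k Q). w = sum_map k C v" by blast
qed

text \<open>
  The space \<open>P\<close> need not lie in the ambient type of \<open>G\<close>. Its preimage \<open>W\<close> under the given
  isomorphism does, and inherits from \<open>G\<close> both its form and its finite dimension.
\<close>

lemma invertible_if_isomorphic_to_double_extension:
  fixes G :: "('g::complex_vector, 'c) quadratic_lie_scheme"
    and P :: "'b::complex_vector quadratic_space"
  assumes G: "quadratic_space G"
    and sub: "complex_vector.subspace (carrier P)" and skew: "skew_symmetric_map P D"
    and bijD: "bij_betw D (carrier P) (carrier P)"
    and iso: "i_isomorphic G (double_extension P D)"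
  shows "invertible_quadratic_lie G"
proof -
  interpret quadratic_space G by fact
  let ?E = "double_extension P D"
  obtain f where bij: "bij_betw f (carrier G) (carrier ?E)" and lin: "linear_on (carrier G) f"
    and form: "\<forall>x\<in>carrier G. \<forall>y\<in>carrier G. form ?E (f x) (f y) = form G x y"
    using iso unfolding i_isomorphic_def by blast
  define g where "g = inv_into (carrier G) f"
  have gG: "g z \<in> carrier G" and fg: "f (g z) = z" if "z \<in> carrier ?E" for z
    using that bij unfolding g_def by (auto simp: bij_betw_def inv_into_into f_inv_into_f)
  have gf: "g (f x) = x" if "x \<in> carrier G" for x
    using that bij unfolding g_def by (auto simp: bij_betw_def)
  have fE: "f x \<in> carrier ?E" if "x \<in> carrier G" for x using bij that by (rule bij_betw_apply)
  have linD: "linear_on (carrier P) D" and DP: "\<And>x. x \<in> carrier P \<Longrightarrow> D x \<in> carrier P"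
    using skew by (auto simp: skew_symmetric_map_def)
  define i where "i = (\<lambda>x. g (0, 0, x))"
  have iG: "i x \<in> carrier G" and fi: "f (i x) = (0, 0, x)" if "x \<in> carrier P" for x
    using that gG[of "(0, 0, x)"] fg[of "(0, 0, x)"] by (auto simp: i_def)
  have lini: "linear_on (carrier P) i"
  proof -
    have "linear_on (carrier ?E) g"
      unfolding g_def by (rule linear_on_inv_into[OF subspace_carrier lin bij])
    moreover have "linear_on (carrier P) (\<lambda>x. (0 :: complex, 0 :: complex, x))"
      by (simp add: linear_on_def)
    ultimately show ?thesis
      unfolding i_def by (rule linear_on_compose[rotated 2]) auto
  qed
  have inji: "inj_on i (carrier P)" using fi by (metis inj_onI prod.inject)
  define W where "W = i ` carrier P"
  have WG: "W \<subseteq> carrier G" using iG by (auto simp: W_def)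
  have subW: "complex_vector.subspace W"
    unfolding complex_vector.subspace_def W_def
  proof (intro conjI ballI allI)
    show "0 \<in> i ` carrier P"
      using linear_on_zero[OF sub lini] complex_vector.subspace_0[OF sub] by (metis imageI)
  next
    fix x y assume "x \<in> i ` carrier P" "y \<in> i ` carrier P"
    then obtain a b where "a \<in> carrier P" "b \<in> carrier P" "x = i a" "y = i b" by blast
    then show "x + y \<in> i ` carrier P"
      using linear_on_add[OF lini, of a b] complex_vector.subspace_add[OF sub, of a b]
      by (metis imageI)
  next
    fix c x assume "x \<in> i ` carrier P"
    then obtain a where "a \<in> carrier P" "x = i a" by blast
    then show "c *\<^sub>C x \<in> i ` carrier P"
      using linear_on_scale[OF lini, of a c] complex_vector.subspace_scale[OF sub, of a c]
      by (metis imageI)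
  qed
  have formi: "form G (i x) (i y) = form P x y" if "x \<in> carrier P" "y \<in> carrier P" for x y
    using form iG fi that by (metis (no_types, lifting) double_extension_simps(2) mult_zero_left add_0)
  have Q: "quadratic_space (subform G W)"
  proof (rule quadratic_subspace[OF subW WG])
    fix x assume "x \<in> W" and orth: "\<And>y. y \<in> W \<Longrightarrow> form G x y = 0"
    then obtain a where a: "a \<in> carrier P" "x = i a" unfolding W_def by blast
    show "x = 0"
    proof (rule form_nondegenerate)
      show "x \<in> carrier G" using a iG by simp
      fix y assume y: "y \<in> carrier G"
      obtain l m b where b: "f y = (l, m, b)" by (metis prod_cases3)
      then have bP: "b \<in> carrier P" using fE[OF y] by simp
      have "form G x y = form ?E (f x) (f y)" using form y a iG by simp
      also have "\<dots> = form P a b" using a fi b by simp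
      also have "\<dots> = form G x (i b)" using formi a bP by simp
      also have "\<dots> = 0" using orth bP by (auto simp: W_def)
      finally show "form G x y = 0" .
    qed
  qed
  define h where "h = inv_into (carrier P) i"
  have hi: "h (i x) = x" if "x \<in> carrier P" for x using inji that by (simp add: h_def)
  define D' where "D' = (\<lambda>x. i (D (h x)))"
  have D'i: "D' (i x) = i (D x)" if "x \<in> carrier P" for x using hi that by (simp add: D'_def)
  have biji: "bij_betw i (carrier P) W" using inji by (simp add: W_def bij_betw_def)
  have conj: "intertwining_isometry P D (subform G W) D' i"
    using biji lini formi D'i DP by (simp add: intertwining_isometry_def)
  have bijh: "bij_betw h W (carrier P)" unfolding h_def by (rule bij_betw_inv_into[OF biji])
  have linh: "linear_on W h" unfolding h_def by (rule linear_on_inv_into[OF sub lini biji])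
  have "bij_betw (i \<circ> (D \<circ> h)) W W"
    by (intro bij_betw_trans[OF _ biji] bij_betw_trans[OF bijh bijD])
  then have bijD': "bij_betw D' W W" by (simp add: D'_def o_def)
  have "linear_on W D'"
    unfolding D'_def
    using linear_on_compose[OF linear_on_compose[OF linh _ linD] _ lini] bijh DP
    by (auto simp: bij_betw_def)
  moreover have "form G (D' x) y = - form G x (D' y)" if xy: "x \<in> W" "y \<in> W" for x y
  proof -
    obtain a where "a \<in> carrier P" "x = i a" using xy unfolding W_def by blast
    moreover obtain b where "b \<in> carrier P" "y = i b" using xy unfolding W_def by blast
    ultimately show ?thesis using D'i formi DP skew by (simp add: skew_symmetric_map_def)
  qed
  ultimately have "skew_symmetric_map (subform G W) D'"
    using bijD' by (auto simp: skew_symmetric_map_def bij_betw_def)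
  moreover have "i_isomorphic G (double_extension (subform G W) D')"
    using iso double_extension_intertwining[OF sub conj] by (rule i_isomorphic_trans)
  ultimately show ?thesis
    unfolding invertible_quadratic_lie_def using Q bijD' by (metis partial_object.select_convs(1))
qed

section \<open>Dual Jordan chains\<close>

locale skew_map = quadratic_space Q
  for Q :: "'a::complex_vector quadratic_space" +
  fixes C :: "'a \<Rightarrow> 'a"
  assumes skew_map: "skew_symmetric_map Q C"
begin

sublocale endomorphism "carrier Q" C
  by (rule skew_endomorphism[OF quadratic_space_axioms skew_map])

lemma skew: "x \<in> carrier Q \<Longrightarrow> y \<in> carrier Q \<Longrightarrow> form Q (C x) y = - form Q x (C y)"
  using skew_map by (auto simp: skew_symmetric_map_def)

text \<open>
  The adjoint of \<open>C - c\<close> is \<open>- (C + c)\<close>, so the shifts by \<open>c\<close> and \<open>- c\<close> are used in pairs.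
\<close>

definition shift :: "complex \<Rightarrow> 'a \<Rightarrow> 'a" where
  "shift c x = C x - c *\<^sub>C x"

sublocale shift: endomorphism "carrier Q" "shift c" for c
  using endomorphism_minus_scalar[of c] by (simp add: shift_def[abs_def])

lemma shift_adjoint:
  "x \<in> carrier Q \<Longrightarrow> y \<in> carrier Q \<Longrightarrow> form Q (shift c x) y = - form Q x (shift (- c) y)"
  by (simp add: shift_def skew form_diff_left form_add_right form_scale_left form_scale_right
      maps carrier_scale)

lemma shift_pow_adjoint:
  "x \<in> carrier Q \<Longrightarrow> y \<in> carrier Q \<Longrightarrow>
     form Q ((shift c ^^ k) x) y = (- 1) ^ k * form Q x ((shift (- c) ^^ k) y)"
proof (induction k arbitrary: y)
  case (Suc k)
  have "form Q ((shift c ^^ Suc k) x) y = - form Q ((shift c ^^ k) x) (shift (- c) y)"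
    using Suc.prems by (simp add: shift_adjoint shift.pow_maps)
  also have "\<dots> = - ((- 1) ^ k * form Q x ((shift (- c) ^^ k) (shift (- c) y)))"
    using Suc.prems by (simp add: Suc.IH shift.maps)
  finally show ?case by (simp add: funpow_swap1)
qed simp

text \<open>
  With \<open>N = C - c\<close>, skew-symmetry gives \<open>B(N x, y) + B(x, N y) = - 2 c B(x, y)\<close>, and both
  terms on the left vanish by induction on the sum of the nilpotency orders of \<open>x\<close> and \<open>y\<close>.
\<close>

lemma generalised_eigenvectors_orthogonal:
  assumes c: "c \<noteq> 0"
  shows "x \<in> carrier Q \<Longrightarrow> y \<in> carrier Q \<Longrightarrow> (shift c ^^ k) x = 0 \<Longrightarrow> (shift c ^^ l) y = 0
    \<Longrightarrow> form Q x y = 0"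
proof (induction "k + l" arbitrary: k l x y rule: less_induct)
  case less
  consider "k = 0" | "l = 0" | k' l' where "k = Suc k'" "l = Suc l'" by (metis not0_implies_Suc)
  then show ?case
  proof cases
    case 3
    have 1: "form Q (shift c x) y = 0"
      using less.hyps[of k' l "shift c x" y] less.prems 3 shift.maps by (simp add: funpow_swap1)
    have 2: "form Q x (shift c y) = 0"
      using less.hyps[of k l' x "shift c y"] less.prems 3 shift.maps by (simp add: funpow_swap1)
    have "form Q (shift c x) y + form Q x (shift c y) = - 2 * c * form Q x y"
      using less.prems by (simp add: shift_def skew form_diff_left form_diff_right form_scale_left
          form_scale_right maps carrier_scale)
    then show ?thesis using 1 2 c by simp
  qed (use less.prems form_zero_left form_zero_right in auto)
qed

lemma shift_pow_pow: "(shift c ^^ k) ((shift c ^^ l) x) = (shift c ^^ (k + l)) x"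
  by (simp add: funpow_add)

text \<open>
  With \<open>N = C - c\<close> and \<open>M = C + c\<close>, choose the least \<open>p\<close> such that \<open>N\<^sup>p\<close> kills the generalised
  kernel of \<open>N\<close>, and \<open>v\<close> in this kernel with \<open>N\<^sup>p\<^sup>-\<^sup>1 v \<noteq> 0\<close>; the index \<open>q\<close> is \<open>p - 1\<close>. A vector not
  orthogonal to \<open>N\<^sup>p\<^sup>-\<^sup>1 v\<close> can be replaced by its component \<open>y\<close> in the generalised kernel of \<open>M\<close>,
  since the image of \<open>M\<^sup>n\<close> is orthogonal to the kernel of \<open>N\<^sup>n\<close>. Finally \<open>M\<^sup>p y = 0\<close>, because
  \<open>B(a, M\<^sup>p y) = \<plusminus> B(N\<^sup>p a, y)\<close> vanishes for \<open>a\<close> in the kernel and in the image of \<open>N\<^sup>n\<close> alike.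
\<close>

lemma paired_nilpotent_vectors:
  assumes n: "dim_at_most (carrier Q) n" and x: "x \<in> carrier Q" "x \<noteq> 0" "C x = c *\<^sub>C x"
  obtains q v w where "v \<in> carrier Q" "w \<in> carrier Q"
    "(shift c ^^ Suc q) v = 0" "(shift (- c) ^^ Suc q) w = 0" "form Q ((shift c ^^ q) v) w = 1"
proof -
  let ?N = "shift c" and ?M = "shift (- c)"
  define P where "P k \<longleftrightarrow> (\<forall>y\<in>carrier Q. (?N ^^ n) y = 0 \<longrightarrow> (?N ^^ k) y = 0)" for k
  define p where "p = (LEAST k. P k)"
  have Pp: "P p" unfolding p_def by (rule LeastI[of P n]) (simp add: P_def)
  have "(?N ^^ 1) x = 0" using x by (simp add: shift_def)
  then have "(?N ^^ n) x = 0" using shift.kernel_stabilises[OF n x(1)] by blast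
  then have "\<not> P 0" using x by (auto simp: P_def)
  then obtain q where q: "p = Suc q" using Pp by (cases p) auto
  then have "\<not> P q" unfolding p_def using not_less_Least[of q P] by simp
  then obtain v where v: "v \<in> carrier Q" "(?N ^^ n) v = 0" "(?N ^^ q) v \<noteq> 0"
    unfolding P_def by blast
  have vp: "(?N ^^ Suc q) v = 0" using Pp v q unfolding P_def by blast
  obtain u where u: "u \<in> carrier Q" "form Q ((?N ^^ q) v) u \<noteq> 0"
    using form_nondegenerate[OF shift.pow_maps[OF v(1)]] v(3) by blast
  obtain y z where yz: "y \<in> carrier Q" "z \<in> carrier Q" "u = y + (?M ^^ n) z" "(?M ^^ n) y = 0"
    using shift.fitting_decomposition[OF n u(1)] by blast
  have Nnq: "(?N ^^ n) ((?N ^^ q) v) = 0"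
    using v by (metis shift_pow_pow add.commute shift.pow_zero)
  have "form Q ((?N ^^ q) v) ((?M ^^ n) z) = (- 1) ^ n * form Q ((?N ^^ n) ((?N ^^ q) v)) z"
    using shift_pow_adjoint[OF shift.pow_maps[OF v(1)] yz(2), of n c]
    by (simp add: power_mult_distrib[symmetric] mult.assoc[symmetric])
  also have "\<dots> = 0" using Nnq yz form_zero_left by simp
  finally have t: "form Q ((?N ^^ q) v) y \<noteq> 0"
    using u yz shift.pow_maps v(1) by (simp add: form_add_right)
  define w where "w = inverse (form Q ((?N ^^ q) v) y) *\<^sub>C y"
  have w: "w \<in> carrier Q" "form Q ((?N ^^ q) v) w = 1"
    using t yz carrier_scale shift.pow_maps v(1) by (simp_all add: w_def form_scale_right)
  have wn: "(?M ^^ n) w = 0" using yz by (simp add: w_def shift.pow_scale)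
  have "(?M ^^ p) w = 0"
  proof (rule form_nondegenerate)
    show "(?M ^^ p) w \<in> carrier Q" using w shift.pow_maps by simp
    fix a assume a: "a \<in> carrier Q"
    obtain b d where bd: "b \<in> carrier Q" "d \<in> carrier Q" "a = b + (?N ^^ n) d" "(?N ^^ n) b = 0"
      using shift.fitting_decomposition[OF n a] by blast
    have "(?N ^^ p) b = 0" using Pp bd unfolding P_def by blast
    then have "(?N ^^ p) a = (?N ^^ n) ((?N ^^ p) d)"
      using bd shift.pow_maps by (simp add: shift.pow_add shift_pow_pow add.commute)
    then have "form Q ((?N ^^ p) a) w = 0"
      using shift_pow_adjoint[OF shift.pow_maps[OF bd(2)] w(1), of n c] wn
        form_zero_right[OF shift.pow_maps[OF bd(2)]] by simp
    then have "form Q a ((?M ^^ p) w) = 0" using shift_pow_adjoint[OF a w(1), of p c] by simp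
    then show "form Q ((?M ^^ p) w) a = 0"
      using form_symmetric[OF a shift.pow_maps[OF w(1)]] by simp
  qed
  then show thesis using that[OF v(1) w(1) vp _ w(2)] q by simp
qed

text \<open>
  Subtracting multiples of \<open>M w, M\<^sup>2 w, ...\<close> from \<open>w\<close> removes the pairings with
  \<open>N\<^sup>q\<^sup>-\<^sup>1 v, N\<^sup>q\<^sup>-\<^sup>2 v, ...\<close> one after the other: the vector \<open>M\<^sup>k w\<close> pairs to \<open>\<plusminus> 1\<close> with
  \<open>N\<^sup>q\<^sup>-\<^sup>k v\<close> and to \<open>0\<close> with the later members of the chain.
\<close>

lemma dual_chains:
  assumes n: "dim_at_most (carrier Q) n" and x: "x \<in> carrier Q" "x \<noteq> 0" "C x = c *\<^sub>C x"
  obtains q v w where "v \<in> carrier Q" "w \<in> carrier Q"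
    "(shift c ^^ Suc q) v = 0" "(shift (- c) ^^ Suc q) w = 0"
    "\<And>i. form Q ((shift c ^^ i) v) w = (if i = q then 1 else 0)"
proof -
  let ?N = "shift c" and ?M = "shift (- c)"
  obtain q v w0 where v1: "v \<in> carrier Q" and w1: "w0 \<in> carrier Q"
    and v2: "(?N ^^ Suc q) v = 0" and w2: "(?M ^^ Suc q) w0 = 0" "form Q ((?N ^^ q) v) w0 = 1"
    by (rule paired_nilpotent_vectors[OF n x])
  note v = v1 v2 and w0 = w1 w2
  have high: "(?N ^^ i) v = 0" if "i > q" for i
    using shift.pow_eq_0_mono[OF v(2)] that by simp
  have "\<exists>w\<in>carrier Q. (?M ^^ Suc q) w = 0 \<and>
      (\<forall>i. q - k \<le> i \<longrightarrow> form Q ((?N ^^ i) v) w = (if i = q then 1 else 0))" for k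
  proof (induction k)
    case 0
    have "form Q ((?N ^^ i) v) w0 = (if i = q then 1 else 0)" if "q \<le> i" for i
      using high[of i] w0 form_zero_left that by auto
    then show ?case using w0 by auto
  next
    case (Suc k)
    then obtain w where w: "w \<in> carrier Q" "(?M ^^ Suc q) w = 0"
      and dual: "\<And>i. q - k \<le> i \<Longrightarrow> form Q ((?N ^^ i) v) w = (if i = q then 1 else 0)" by blast
    show ?case
    proof (cases "q \<le> k")
      case True
      then show ?thesis using w dual by auto
    next
      case False
      define j where "j = q - Suc k"
      \<comment> \<open>The pairing with \<open>N\<^sup>j v\<close> is the one to be removed in this step.\<close>
      define s where "s = (- 1) ^ Suc k * form Q ((?N ^^ j) v) w"
      define w' where "w' = w - s *\<^sub>C (?M ^^ Suc k) w"
      have Mw: "(?M ^^ Suc k) w \<in> carrier Q" using w shift.pow_maps by blast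
      have w'Q: "w' \<in> carrier Q" unfolding w'_def using w Mw by (intro carrier_diff carrier_scale)
      have "(?M ^^ Suc q) ((?M ^^ Suc k) w) = 0"
        using w(2) by (metis shift_pow_pow add.commute shift.pow_zero)
      then have "(?M ^^ Suc q) w' = 0"
        unfolding w'_def using w Mw carrier_scale
        by (simp add: shift.pow_diff shift.pow_scale del: funpow.simps)
      moreover have "form Q ((?N ^^ i) v) w' = (if i = q then 1 else 0)" if "q - Suc k \<le> i" for i
      proof -
        have Ni: "(?N ^^ i) v \<in> carrier Q" using v shift.pow_maps by blast
        have "form Q ((?N ^^ (Suc k + i)) v) w = (- 1) ^ Suc k * form Q ((?N ^^ i) v) ((?M ^^ Suc k) w)"
          using shift_pow_adjoint[OF Ni w(1), of "Suc k" c] by (simp only: shift_pow_pow)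
        then have adj: "form Q ((?N ^^ i) v) ((?M ^^ Suc k) w)
            = (- 1) ^ Suc k * form Q ((?N ^^ (Suc k + i)) v) w"
          by (simp add: mult.assoc[symmetric] power_mult_distrib[symmetric] del: funpow.simps)
        have w': "form Q ((?N ^^ i) v) w' = form Q ((?N ^^ i) v) w
            - s * ((- 1) ^ Suc k * form Q ((?N ^^ (Suc k + i)) v) w)"
          unfolding w'_def adj[symmetric] using Ni w Mw carrier_scale
          by (simp add: form_diff_right form_scale_right del: funpow.simps)
        show ?thesis
        proof (cases "i = j")
          case True
          then have "form Q ((?N ^^ (Suc k + i)) v) w = 1"
            using dual[of "Suc k + i"] False by (simp add: j_def del: funpow.simps)
          moreover have "i \<noteq> q" using True False by (simp add: j_def)
          moreover have "s * (- 1) ^ Suc k = form Q ((?N ^^ i) v) w"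
            by (simp add: s_def True power_mult_distrib[symmetric] mult.commute mult.left_commute)
          ultimately show ?thesis unfolding w' by simp
        next
          case False
          then have "q - k \<le> i" using that by (simp add: j_def)
          moreover have "form Q ((?N ^^ (Suc k + i)) v) w = 0"
            using dual[of "Suc k + i"] high[of "Suc k + i"] form_zero_left[OF w(1)] \<open>q - k \<le> i\<close>
            by (simp del: funpow.simps)
          ultimately show ?thesis unfolding w' using dual by simp
        qed
      qed
      ultimately show ?thesis using w'Q by blast
    qed
  qed
  from this[of q] obtain w where "w \<in> carrier Q" "(?M ^^ Suc q) w = 0"
    "\<And>i. form Q ((?N ^^ i) v) w = (if i = q then 1 else 0)" by auto
  then show thesis using that v by blast
qed

section \<open>Splitting off a Jordan block\<close>

text \<open>
  The relations that the canonical basis of the hyperbolic space satisfies with respect to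
  the block matrix of a Jordan-type algebra; indices start from \<open>0\<close>.
\<close>

definition jordan_frame :: "nat \<Rightarrow> complex \<Rightarrow> (nat \<Rightarrow> 'a) \<Rightarrow> (nat \<Rightarrow> 'a) \<Rightarrow> bool" where
  "jordan_frame p lam E F \<longleftrightarrow>
     (\<forall>i<p. E i \<in> carrier Q \<and> F i \<in> carrier Q \<and>
        C (E i) = lam *\<^sub>C E i + (if i = 0 then 0 else E (i - 1)) \<and>
        C (F i) = - (lam *\<^sub>C F i) - (if Suc i < p then F (Suc i) else 0)) \<and>
     (\<forall>i<p. \<forall>j<p. form Q (E i) (E j) = 0 \<and> form Q (F i) (F j) = 0 \<and>
        form Q (E i) (F j) = (if i = j then 1 else 0))"

text \<open>
  The \<open>E\<^sub>i\<close> run through the chain of \<open>v\<close> backwards, so that \<open>C - c\<close> lowers the index. The signs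
  in \<open>F\<^sub>i = (- 1)\<^sup>i (C + c)\<^sup>i w\<close> cancel those of the adjoint, which makes the two chains dual.
\<close>

lemma jordan_frame_exists:
  assumes n: "dim_at_most (carrier Q) n" and c: "c \<noteq> 0"
    and x: "x \<in> carrier Q" "x \<noteq> 0" "C x = c *\<^sub>C x"
  obtains p E F where "p \<ge> 1" "jordan_frame p c E F"
proof -
  let ?N = "shift c" and ?M = "shift (- c)"
  obtain q v w where v1: "v \<in> carrier Q" and w1: "w \<in> carrier Q"
    and v2: "(?N ^^ Suc q) v = 0" and w2: "(?M ^^ Suc q) w = 0"
    and dual: "\<And>i. form Q ((?N ^^ i) v) w = (if i = q then 1 else 0)"
    by (rule dual_chains[OF n x]) (rule that)
  note v = v1 v2 and w = w1 w2
  define E where "E i = (?N ^^ (q - i)) v" for i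
  define F where "F i = (- 1) ^ i *\<^sub>C (?M ^^ i) w" for i
  have EQ: "E i \<in> carrier Q" and FQ: "F i \<in> carrier Q" for i
    using v w shift.pow_maps carrier_scale by (auto simp: E_def F_def)
  have Eker: "(?N ^^ Suc q) (E i) = 0" for i
    unfolding E_def using v(2) by (metis shift_pow_pow add.commute shift.pow_zero)
  have Fker: "(?M ^^ Suc q) (F i) = 0" for i
  proof -
    have "(?M ^^ Suc q) ((?M ^^ i) w) = 0"
      using w(2) by (metis shift_pow_pow add.commute shift.pow_zero)
    then show ?thesis
      unfolding F_def using w shift.pow_maps by (simp add: shift.pow_scale del: funpow.simps)
  qed
  have CE: "C (E i) = c *\<^sub>C E i + (if i = 0 then 0 else E (i - 1))" if "i < Suc q" for i
  proof -
    have "?N (E i) = (?N ^^ Suc (q - i)) v" by (simp add: E_def)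
    also have "\<dots> = (if i = 0 then 0 else E (i - 1))"
    proof (cases "i = 0")
      case False
      then have "Suc (q - i) = q - (i - 1)" using that by simp
      then show ?thesis using False by (simp only: E_def if_False)
    qed (use v in simp)
    finally show ?thesis by (simp add: shift_def algebra_simps)
  qed
  have CF: "C (F i) = - (c *\<^sub>C F i) - (if Suc i < Suc q then F (Suc i) else 0)" if "i < Suc q" for i
  proof -
    have "?M (F i) = (- 1) ^ i *\<^sub>C (?M ^^ Suc i) w"
      unfolding F_def using linear_on_scale[OF shift.linear shift.pow_maps[OF w(1)]] by simp
    also have "\<dots> = - (if Suc i < Suc q then F (Suc i) else 0)"
    proof (cases "Suc i < Suc q")
      case True
      then show ?thesis by (simp add: F_def del: funpow.simps)
    next
      case False
      then have "Suc i = Suc q" using that by simp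
      then show ?thesis using w(2) by (simp only: if_False) simp
    qed
    finally have "?M (F i) = - (if Suc i < Suc q then F (Suc i) else 0)" .
    moreover have "C (F i) = ?M (F i) - c *\<^sub>C F i" by (simp add: shift_def)
    ultimately show ?thesis by simp
  qed
  have "form Q (E i) (F j) = (if i = j then 1 else 0)" if "i < Suc q" for i j
  proof -
    have "form Q (E i) (F j) = (- 1) ^ j * form Q (E i) ((?M ^^ j) w)"
      unfolding F_def by (rule form_scale_right[OF EQ shift.pow_maps[OF w(1)]])
    also have "\<dots> = form Q ((?N ^^ j) (E i)) w"
      using shift_pow_adjoint[OF EQ w(1)] by simp
    also have "\<dots> = form Q ((?N ^^ (j + (q - i))) v) w" by (simp only: E_def shift_pow_pow)
    also have "\<dots> = (if i = j then 1 else 0)" using dual that by auto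
    finally show ?thesis .
  qed
  moreover have "form Q (E i) (E j) = 0" for i j
    by (rule generalised_eigenvectors_orthogonal[OF c EQ EQ Eker Eker])
  moreover have "form Q (F i) (F j) = 0" for i j
    using generalised_eigenvectors_orthogonal[of "- c", OF _ FQ FQ Fker Fker] c by simp
  ultimately have "jordan_frame (Suc q) c E F"
    unfolding jordan_frame_def using EQ FQ CE CF by simp
  then show thesis using that[of "Suc q"] by simp
qed

end

context skew_map
begin

definition frame_map :: "nat \<Rightarrow> (nat \<Rightarrow> 'a) \<Rightarrow> (nat \<Rightarrow> 'a) \<Rightarrow> (nat \<Rightarrow> complex) \<Rightarrow> 'a" where
  "frame_map p E F v = (\<Sum>i<p. v i *\<^sub>C E i + v (p + i) *\<^sub>C F i)"

context
  fixes p lam E F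
  assumes frame: "jordan_frame p lam E F"
begin

lemma frame_carrier: "i < p \<Longrightarrow> E i \<in> carrier Q" "i < p \<Longrightarrow> F i \<in> carrier Q"
  using frame by (auto simp: jordan_frame_def)

lemma frame_form:
  assumes "i < p" "j < p"
  shows "form Q (E i) (E j) = 0" "form Q (F i) (F j) = 0"
    "form Q (E i) (F j) = (if i = j then 1 else 0)" "form Q (F i) (E j) = (if i = j then 1 else 0)"
  using frame assms form_symmetric[of "F i" "E j"] frame_carrier by (auto simp: jordan_frame_def)

lemma frame_term_carrier: "i < p \<Longrightarrow> a *\<^sub>C E i + b *\<^sub>C F i \<in> carrier Q"
  using frame_carrier by (intro carrier_add carrier_scale)

lemma frame_map_carrier: "frame_map p E F v \<in> carrier Q"
  unfolding frame_map_def using frame_term_carrier by (intro carrier_sum) auto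

lemma form_frame_map_right:
  assumes x: "x \<in> carrier Q"
  shows "form Q x (frame_map p E F v) = (\<Sum>i<p. v i * form Q x (E i) + v (p + i) * form Q x (F i))"
proof -
  have "form Q x (frame_map p E F v) = (\<Sum>i<p. form Q x (v i *\<^sub>C E i + v (p + i) *\<^sub>C F i))"
    unfolding frame_map_def using frame_term_carrier by (intro form_sum_right[OF x]) auto
  also have "\<dots> = (\<Sum>i<p. v i * form Q x (E i) + v (p + i) * form Q x (F i))"
    using frame_carrier carrier_scale x
    by (intro sum.cong) (auto simp: form_add_right form_scale_right)
  finally show ?thesis .
qed

lemma form_frame_map:
  assumes "j < p"
  shows "form Q (frame_map p E F v) (E j) = v (p + j)" "form Q (frame_map p E F v) (F j) = v j"
proof -
  have "form Q (frame_map p E F v) (E j) = (\<Sum>i<p. if i = j then v (p + i) else 0)"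
    unfolding form_symmetric[OF frame_map_carrier frame_carrier(1)[OF assms]]
      form_frame_map_right[OF frame_carrier(1)[OF assms]]
    by (intro sum.cong) (auto simp: frame_form assms)
  then show "form Q (frame_map p E F v) (E j) = v (p + j)" using assms by simp
  have "form Q (frame_map p E F v) (F j) = (\<Sum>i<p. if i = j then v i else 0)"
    unfolding form_symmetric[OF frame_map_carrier frame_carrier(2)[OF assms]]
      form_frame_map_right[OF frame_carrier(2)[OF assms]]
    by (intro sum.cong) (auto simp: frame_form assms)
  then show "form Q (frame_map p E F v) (F j) = v j" using assms by simp
qed

lemma frame_map_add: "frame_map p E F (v + w) = frame_map p E F v + frame_map p E F w"
  by (simp add: frame_map_def sum.distrib algebra_simps)

lemma frame_map_scale: "frame_map p E F (c *\<^sub>C v) = c *\<^sub>C frame_map p E F v"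
  by (simp add: frame_map_def scaleC_fun_def scaleC_complex_def complex_vector.scale_sum_right
      complex_vector.scale_right_distrib)

lemma frame_map_isometry:
  "form Q (frame_map p E F v) (frame_map p E F w) = form (hyperbolic_space p) v w"
  unfolding form_frame_map_right[OF frame_map_carrier]
  by (auto simp: hyperbolic_space_def form_frame_map algebra_simps intro!: sum.cong)

text \<open>
  The frame relations are the columns of the matrix, its coordinate description gives the
  rows; passing from one to the other shifts the index in the two sums over neighbours.
\<close>

lemma frame_map_jordan:
  "C (frame_map p E F v) = frame_map p E F (mat_map (jordan_skew_mat p lam) v)"
proof -
  have "C (frame_map p E F v) = (\<Sum>i<p. v i *\<^sub>C C (E i) + v (p + i) *\<^sub>C C (F i))"
    unfolding frame_map_def using frame_term_carrier frame_carrier carrier_scale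
    by (subst linear_on_sum[OF subspace linear])
      (auto simp: linear_on_add[OF linear] linear_on_scale[OF linear] intro!: sum.cong)
  also have "\<dots> = (\<Sum>i<p. (lam * v i) *\<^sub>C E i - (lam * v (p + i)) *\<^sub>C F i)
      + (\<Sum>i<p. v i *\<^sub>C (if i = 0 then 0 else E (i - 1)))
      - (\<Sum>i<p. v (p + i) *\<^sub>C (if Suc i < p then F (Suc i) else 0))"
    using frame unfolding sum.distrib[symmetric] sum_subtractf[symmetric]
    by (intro sum.cong) (auto simp: jordan_frame_def complex_vector.scale_right_distrib
        complex_vector.scale_right_diff_distrib mult.commute)
  also have "(\<Sum>i<p. v i *\<^sub>C (if i = 0 then 0 else E (i - 1)))
      = (\<Sum>i<p. (if Suc i < p then v (Suc i) else 0) *\<^sub>C E i)"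
  proof (cases p)
    case (Suc q)
    have "(\<Sum>i<Suc q. v i *\<^sub>C (if i = 0 then 0 else E (i - 1))) = (\<Sum>i<q. v (Suc i) *\<^sub>C E i)"
      by (subst sum.lessThan_Suc_shift) simp
    also have "\<dots> = (\<Sum>i<Suc q. (if Suc i < Suc q then v (Suc i) else 0) *\<^sub>C E i)"
      by simp
    finally show ?thesis unfolding Suc .
  qed simp
  also have "(\<Sum>i<p. v (p + i) *\<^sub>C (if Suc i < p then F (Suc i) else 0))
      = (\<Sum>i<p. (if i = 0 then 0 else v (p + i - 1)) *\<^sub>C F i)"
  proof (cases p)
    case (Suc q)
    have "(\<Sum>i<Suc q. v (p + i) *\<^sub>C (if Suc i < Suc q then F (Suc i) else 0))
        = (\<Sum>i<q. v (p + i) *\<^sub>C F (Suc i))"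
      by simp
    also have "\<dots> = (\<Sum>i<Suc q. (if i = 0 then 0 else v (p + i - 1)) *\<^sub>C F i)"
      by (subst sum.lessThan_Suc_shift) simp
    finally show ?thesis unfolding Suc .
  qed simp
  also have "(\<Sum>i<p. (lam * v i) *\<^sub>C E i - (lam * v (p + i)) *\<^sub>C F i)
      + (\<Sum>i<p. (if Suc i < p then v (Suc i) else 0) *\<^sub>C E i)
      - (\<Sum>i<p. (if i = 0 then 0 else v (p + i - 1)) *\<^sub>C F i)
      = frame_map p E F (mat_map (jordan_skew_mat p lam) v)"
    unfolding frame_map_def sum.distrib[symmetric] sum_subtractf[symmetric]
    by (intro sum.cong)
      (auto simp: jordan_skew_map_apply complex_vector.scale_left_distrib
        complex_vector.scale_left_diff_distrib)
  finally show ?thesis .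
qed

definition frame_span :: "'a set" where
  "frame_span = frame_map p E F ` carrier (hyperbolic_space p)"

lemma frame_span_subset: "frame_span \<subseteq> carrier Q"
  using frame_map_carrier by (auto simp: frame_span_def)

lemma subspace_frame_span: "complex_vector.subspace frame_span"
  unfolding complex_vector.subspace_def frame_span_def
proof (intro conjI ballI allI)
  have "frame_map p E F 0 = 0" by (simp add: frame_map_def)
  then show "0 \<in> frame_map p E F ` carrier (hyperbolic_space p)"
    using complex_vector.subspace_0[OF subspace_hyperbolic] by (metis imageI)
qed (auto simp: frame_map_add[symmetric] frame_map_scale[symmetric] intro!: imageI
    complex_vector.subspace_add[OF subspace_hyperbolic]
    complex_vector.subspace_scale[OF subspace_hyperbolic])

lemma frame_in_span: "j < p \<Longrightarrow> E j \<in> frame_span" "j < p \<Longrightarrow> F j \<in> frame_span"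
proof -
  assume j: "j < p"
  let ?e = "\<lambda>k i. if i = k then 1 else 0 :: complex"
  have e: "?e j \<in> carrier (hyperbolic_space p)" "?e (p + j) \<in> carrier (hyperbolic_space p)"
    using j by (auto simp: hyperbolic_space_def)
  have "frame_map p E F (?e j) = (\<Sum>i<p. if i = j then E i else 0)"
    unfolding frame_map_def using j by (intro sum.cong) auto
  then have "E j = frame_map p E F (?e j)" using j by simp
  then show "E j \<in> frame_span" using e unfolding frame_span_def by blast
  have "frame_map p E F (?e (p + j)) = (\<Sum>i<p. if i = j then F i else 0)"
    unfolding frame_map_def using j by (intro sum.cong) auto
  then have "F j = frame_map p E F (?e (p + j))" using j by simp
  then show "F j \<in> frame_span" using e unfolding frame_span_def by blast
qed

lemma frame_map_eq_0:
  assumes "v \<in> carrier (hyperbolic_space p)"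
    and "\<And>j. j < p \<Longrightarrow> form Q (frame_map p E F v) (E j) = 0"
    and "\<And>j. j < p \<Longrightarrow> form Q (frame_map p E F v) (F j) = 0"
  shows "v = 0"
proof
  fix i
  consider "i < p" | "i - p < p" "i = p + (i - p)" | "2 * p \<le> i" by linarith
  then show "v i = 0 i"
  proof cases
    case 1 then show ?thesis using assms(3)[of i] form_frame_map(2)[of i v] by simp
  next
    case 2 then show ?thesis using assms(2)[of "i - p"] form_frame_map(1)[of "i - p" v] by simp
  next
    case 3 then show ?thesis using assms(1) by (simp add: hyperbolic_space_def)
  qed
qed

lemma quadratic_space_frame_span: "quadratic_space (subform Q frame_span)"
proof (rule quadratic_subspace[OF subspace_frame_span frame_span_subset])
  fix x assume "x \<in> frame_span" and orth: "\<And>y. y \<in> frame_span \<Longrightarrow> form Q x y = 0"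
  then obtain v where "v \<in> carrier (hyperbolic_space p)" "x = frame_map p E F v"
    unfolding frame_span_def by blast
  then have "v = 0" using frame_map_eq_0 orth frame_in_span by blast
  then show "x = 0" using \<open>x = frame_map p E F v\<close> by (simp add: frame_map_def)
qed

lemma jordan_map_closed: "mat_map (jordan_skew_mat p lam) v \<in> carrier (hyperbolic_space p)"
  by (simp add: hyperbolic_space_def jordan_skew_map_outside)

lemma skew_frame_span: "skew_symmetric_map (subform Q frame_span) C"
  unfolding skew_symmetric_map_def
proof (intro conjI ballI)
  show "C ` carrier (subform Q frame_span) \<subseteq> carrier (subform Q frame_span)"
    using frame_map_jordan jordan_map_closed by (auto simp: frame_span_def)
  show "linear_on (carrier (subform Q frame_span)) C"
    using linear_on_subset[OF linear frame_span_subset] by simp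
qed (use skew frame_span_subset in auto)

lemma intertwining_isometry_frame_map:
  "intertwining_isometry (hyperbolic_space p) (mat_map (jordan_skew_mat p lam)) (subform Q frame_span) C
    (frame_map p E F)"
proof -
  have "inj_on (frame_map p E F) (carrier (hyperbolic_space p))"
  proof (rule inj_onI)
    fix v w assume vw: "v \<in> carrier (hyperbolic_space p)" "w \<in> carrier (hyperbolic_space p)"
      and eq: "frame_map p E F v = frame_map p E F w"
    have "frame_map p E F (v - w) + frame_map p E F w = frame_map p E F v"
      unfolding frame_map_add[symmetric] by simp
    then have "frame_map p E F (v - w) = 0" using eq by simp
    then have "v - w = 0"
      using frame_map_eq_0[OF complex_vector.subspace_diff[OF subspace_hyperbolic vw]]
        form_zero_left frame_carrier by simp
    then show "v = w" by simp
  qed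
  then have "bij_betw (frame_map p E F) (carrier (hyperbolic_space p)) frame_span"
    by (simp add: bij_betw_def frame_span_def)
  then show ?thesis
    by (simp add: intertwining_isometry_def linear_on_def frame_map_add frame_map_scale frame_map_isometry
        frame_map_jordan jordan_map_closed)
qed

lemma jordan_type_frame_span:
  "i_isomorphic (double_extension (subform Q frame_span) C) (jordan_type p lam)"
  unfolding jordan_type_def
  using double_extension_intertwining[OF _ intertwining_isometry_inv[OF subspace_hyperbolic
      intertwining_isometry_frame_map]]
    subspace_frame_span by simp

definition frame_complement :: "'a set" where
  "frame_complement = {x \<in> carrier Q. \<forall>i<p. form Q x (E i) = 0 \<and> form Q x (F i) = 0}"

lemma orthogonal_complement:
  assumes "x \<in> frame_complement" "u \<in> frame_span"
  shows "form Q x u = 0" "form Q u x = 0"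
proof -
  obtain v where v: "u = frame_map p E F v" using assms unfolding frame_span_def by blast
  have x: "x \<in> carrier Q" using assms by (simp add: frame_complement_def)
  show "form Q x u = 0"
    unfolding v form_frame_map_right[OF x] using assms by (simp add: frame_complement_def)
  then show "form Q u x = 0"
    using form_symmetric[OF x] assms frame_span_subset by (metis subsetD)
qed

text \<open>
  The component of \<open>x\<close> in the span has as coordinates the pairings of \<open>x\<close> with the dual
  vectors of the frame.
\<close>

lemma frame_decomposition:
  assumes x: "x \<in> carrier Q"
  obtains u y where "u \<in> frame_span" "y \<in> frame_complement" "x = u + y"
proof -
  define v where "v = (\<lambda>i. if i < p then form Q x (F i)
      else if i < 2 * p then form Q x (E (i - p)) else 0)"
  let ?u = "frame_map p E F v"
  have "v \<in> carrier (hyperbolic_space p)" by (auto simp: v_def hyperbolic_space_def)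
  then have "?u \<in> frame_span" by (simp add: frame_span_def)
  moreover have "x - ?u \<in> frame_complement"
    using x frame_carrier
    by (auto simp: frame_complement_def carrier_diff frame_map_carrier form_diff_left
        form_frame_map v_def)
  ultimately show thesis using that[of ?u "x - ?u"] by simp
qed

lemma subspace_frame_complement: "complex_vector.subspace frame_complement"
  using frame_carrier
  by (auto simp: complex_vector.subspace_def frame_complement_def carrier_zero carrier_add
      carrier_scale form_zero_left form_add_left form_scale_left)

lemma skew_map_frame_complement: "skew_map (subform Q frame_complement) C"
proof (rule skew_map.intro)
  have sub: "frame_complement \<subseteq> carrier Q" by (auto simp: frame_complement_def)
  show "quadratic_space (subform Q frame_complement)"
  proof (rule quadratic_subspace[OF subspace_frame_complement sub])
    fix x assume x: "x \<in> frame_complement"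
      and orth: "\<And>y. y \<in> frame_complement \<Longrightarrow> form Q x y = 0"
    show "x = 0"
    proof (rule form_nondegenerate)
      show "x \<in> carrier Q" using x sub by blast
      fix z assume "z \<in> carrier Q"
      then obtain u y where uy: "u \<in> frame_span" "y \<in> frame_complement" "z = u + y"
        by (rule frame_decomposition)
      then have "x \<in> carrier Q" "u \<in> carrier Q" "y \<in> carrier Q"
        using x sub frame_span_subset by auto
      then show "form Q x z = 0"
        using orth[OF uy(2)] orthogonal_complement(1)[OF x uy(1)] uy(3)
        by (simp add: form_add_right)
    qed
  qed
  have "form Q (C x) u = 0" if "x \<in> frame_complement" "u \<in> frame_span" for x u
  proof -
    have "C u \<in> frame_span" using skew_frame_span that(2) by (auto simp: skew_symmetric_map_def)
    moreover have "x \<in> carrier Q" "u \<in> carrier Q" using that sub frame_span_subset by auto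
    ultimately show ?thesis using orthogonal_complement(1) that skew by simp
  qed
  then have "C ` frame_complement \<subseteq> frame_complement"
    using frame_in_span maps by (auto simp: frame_complement_def)
  then show "skew_map_axioms (subform Q frame_complement) C"
    using linear_on_subset[OF linear sub] skew sub
    by (auto simp: skew_map_axioms_def skew_symmetric_map_def)
qed

text \<open>
  A family in the complement, extended by \<open>E\<^sub>0\<close>, satisfies a relation; pairing with \<open>F\<^sub>0\<close>
  shows that \<open>E\<^sub>0\<close> does not occur in it.
\<close>

lemma dim_frame_complement:
  assumes n: "dim_at_most (carrier Q) (Suc n)" and p: "p \<ge> 1"
  shows "dim_at_most frame_complement n"
  unfolding dim_at_most_def
proof (intro allI impI)
  fix u :: "nat \<Rightarrow> 'a" assume u: "\<forall>i\<le>n. u i \<in> frame_complement"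
  \<comment> \<open>One more vector makes the family large enough for a relation in \<open>Q\<close>.\<close>
  let ?u = "u(Suc n := E 0)"
  have uQ: "u i \<in> carrier Q" if "i \<le> n" for i using u that by (auto simp: frame_complement_def)
  have "\<forall>i\<le>Suc n. ?u i \<in> carrier Q"
    using uQ p frame_carrier(1)[of 0] by (auto simp: le_Suc_eq)
  then obtain a where a: "\<exists>i\<le>Suc n. a i \<noteq> 0" "(\<Sum>i\<le>Suc n. a i *\<^sub>C ?u i) = 0"
    using n unfolding dim_at_most_def by blast
  let ?s = "\<Sum>i\<le>n. a i *\<^sub>C u i"
  have rel: "?s + a (Suc n) *\<^sub>C E 0 = 0" using a(2) by simp
  have s: "?s \<in> frame_complement"
    using u by (intro complex_vector.subspace_sum complex_vector.subspace_scale
        subspace_frame_complement) auto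
  then have sQ: "?s \<in> carrier Q" "form Q ?s (F 0) = 0" using p by (auto simp: frame_complement_def)
  have E0: "E 0 \<in> carrier Q" "F 0 \<in> carrier Q" using p frame_carrier by auto
  have "form Q (?s + a (Suc n) *\<^sub>C E 0) (F 0) = a (Suc n)"
    using sQ E0 p frame_form(3)[of 0 0] carrier_scale by (simp add: form_add_left form_scale_left)
  then have an: "a (Suc n) = 0" using rel form_zero_left E0 by simp
  have "\<exists>i\<le>n. a i \<noteq> 0" using a(1) an by (metis le_Suc_eq)
  then show "\<exists>a. (\<exists>i\<le>n. a i \<noteq> 0) \<and> (\<Sum>i\<le>n. a i *\<^sub>C u i) = 0" using rel an by auto
qed

end

end

section \<open>Orthogonal decomposition into Jordan blocks\<close>

definition jordan_summand ::
    "'a::complex_vector quadratic_space \<Rightarrow> ('a \<Rightarrow> 'a) \<Rightarrow> 'a set \<Rightarrow> bool" where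
  "jordan_summand Q C U \<longleftrightarrow> U \<subseteq> carrier Q \<and> quadratic_space (subform Q U) \<and>
     skew_symmetric_map (subform Q U) C \<and>
     (\<exists>p\<ge>1. \<exists>lam. lam \<noteq> 0 \<and>
        i_isomorphic (double_extension (subform Q U) C) (jordan_type p lam))"

text \<open>
  An eigenvalue of \<open>C\<close> yields a Jordan frame, whose span is one summand; the induction hypothesis
  splits the orthogonal complement.
\<close>

lemma orthogonal_jordan_decomposition:
  assumes "skew_map Q C" "\<forall>x\<in>carrier Q. C x = 0 \<longrightarrow> x = 0" "dim_at_most (carrier Q) n"
  shows "\<exists>(k::nat) U. (\<forall>i<k. jordan_summand Q C (U i)) \<and>
     (\<forall>i<k. \<forall>j<k. i \<noteq> j \<longrightarrow> (\<forall>x\<in>U i. \<forall>y\<in>U j. form Q x y = 0)) \<and>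
     (\<forall>x\<in>carrier Q. \<exists>u. (\<forall>i<k. u i \<in> U i) \<and> x = (\<Sum>i<k. u i))"
  using assms
proof (induction n arbitrary: Q)
  case 0
  interpret skew_map Q C by fact
  have zero: "x = 0" if x: "x \<in> carrier Q" for x
  proof -
    obtain a :: "nat \<Rightarrow> complex" where "a 0 \<noteq> 0" "a 0 *\<^sub>C x = 0"
      using "0.prems"(3) x unfolding dim_at_most_def by (auto dest: spec[of _ "\<lambda>_. x"])
    then show ?thesis by simp
  qed
  show ?case by (intro exI[of _ "0::nat"]) (auto dest: zero)
next
  case (Suc n)
  interpret skew_map Q C by fact
  show ?case
  proof (cases "\<exists>x\<in>carrier Q. x \<noteq> 0")
    case False
    show ?thesis by (intro exI[of _ "0::nat"]) (use False in auto)
  next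
    case True
    then obtain c x where x: "x \<in> carrier Q" "x \<noteq> 0" "C x = c *\<^sub>C x"
      using eigenvector_exists[OF Suc.prems(3)] by metis
    then have c: "c \<noteq> 0" using Suc.prems(2) by auto
    obtain p E F where p: "p \<ge> 1" and frame: "jordan_frame p c E F"
      by (rule jordan_frame_exists[OF Suc.prems(3) c x])
    define U0 where "U0 = frame_span p E F"
    define W where "W = frame_complement p E F"
    let ?W = "subform Q W"
    have WQ: "W \<subseteq> carrier Q" by (auto simp: W_def frame_complement_def[OF frame])
    have U0: "jordan_summand Q C U0"
      unfolding jordan_summand_def U0_def
      using frame_span_subset[OF frame] quadratic_space_frame_span[OF frame]
        skew_frame_span[OF frame] jordan_type_frame_span[OF frame] p c by blast
    have "\<exists>(k::nat) U. (\<forall>i<k. jordan_summand ?W C (U i)) \<and>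
       (\<forall>i<k. \<forall>j<k. i \<noteq> j \<longrightarrow> (\<forall>x\<in>U i. \<forall>y\<in>U j. form ?W x y = 0)) \<and>
       (\<forall>x\<in>carrier ?W. \<exists>u. (\<forall>i<k. u i \<in> U i) \<and> x = (\<Sum>i<k. u i))"
    proof (rule Suc.IH)
      show "skew_map ?W C" unfolding W_def by (rule skew_map_frame_complement[OF frame])
      show "dim_at_most (carrier ?W) n"
        using dim_frame_complement[OF frame Suc.prems(3) p] by (simp add: W_def)
    qed (use Suc.prems(2) WQ in auto)
    then obtain k :: nat and U where all: "\<forall>i<k. jordan_summand ?W C (U i)"
      "\<forall>i<k. \<forall>j<k. i \<noteq> j \<longrightarrow> (\<forall>x\<in>U i. \<forall>y\<in>U j. form ?W x y = 0)"
      "\<forall>x\<in>carrier ?W. \<exists>u. (\<forall>i<k. u i \<in> U i) \<and> x = (\<Sum>i<k. u i)"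
      by (elim exE conjE) (rule that)
    have U: "jordan_summand ?W C (U i)" if "i < k" for i using all(1) that by blast
    have orth: "form Q x y = 0" if "i < k" "j < k" "i \<noteq> j" "x \<in> U i" "y \<in> U j" for i j x y
      using all(2) that by auto
    have span: "\<exists>u. (\<forall>i<k. u i \<in> U i) \<and> x = (\<Sum>i<k. u i)" if "x \<in> W" for x
      using all(3) that by simp
    have UW: "U i \<subseteq> W" if "i < k" for i using U[OF that] by (simp add: jordan_summand_def)
    let ?U = "U(k := U0)"
    have "jordan_summand Q C (?U i)" if "i < Suc k" for i
    proof (cases "i = k")
      case False
      then have "i < k" using that by simp
      then show ?thesis using U[of i] WQ False by (auto simp: jordan_summand_def)
    qed (use U0 in simp)
    moreover have "form Q x y = 0"
      if "i < Suc k" "j < Suc k" "i \<noteq> j" "x \<in> ?U i" "y \<in> ?U j" for i j x y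
    proof -
      have perp: "form Q a b = 0" "form Q b a = 0" if "l < k" "a \<in> U l" "b \<in> U0" for a b l
        using orthogonal_complement[OF frame] UW[OF that(1)] that by (auto simp: W_def U0_def)
      consider "i < k" "j < k" | "i = k" "j < k" | "i < k" "j = k" using \<open>i < Suc k\<close> \<open>j < Suc k\<close> \<open>i \<noteq> j\<close> by linarith
      then show ?thesis using that orth perp by cases auto
    qed
    moreover have "\<exists>u. (\<forall>i<Suc k. u i \<in> ?U i) \<and> x = (\<Sum>i<Suc k. u i)"
      if x: "x \<in> carrier Q" for x
    proof -
      obtain u0 y where uy: "u0 \<in> U0" "y \<in> W" "x = u0 + y"
        using frame_decomposition[OF frame x] unfolding U0_def W_def by blast
      obtain u where u: "\<forall>i<k. u i \<in> U i" "y = (\<Sum>i<k. u i)" using span[OF uy(2)] by blast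
      show ?thesis
        using uy u by (intro exI[of _ "u(k := u0)"]) (auto simp: add.commute less_Suc_eq)
    qed
    ultimately show ?thesis by (intro exI[of _ "Suc k"] exI[of _ ?U]) blast
  qed
qed

section \<open>Invertible algebras are amalgamated products\<close>

text \<open>
  Summation is the isometry from the external to the internal orthogonal sum. It is injective
  because the form is nondegenerate on each summand.
\<close>

lemma intertwining_isometry_orthogonal_sum:
  fixes Q :: "'a::complex_vector quadratic_space" and k :: nat and U :: "nat \<Rightarrow> 'a set"
  assumes Q: "quadratic_space Q" and C: "skew_symmetric_map Q C"
    and U: "\<And>i. i < k \<Longrightarrow> U i \<subseteq> carrier Q" "\<And>i. i < k \<Longrightarrow> quadratic_space (subform Q (U i))"
      "\<And>i. i < k \<Longrightarrow> skew_symmetric_map (subform Q (U i)) C"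
    and orth: "\<And>i j x y. i < k \<Longrightarrow> j < k \<Longrightarrow> i \<noteq> j \<Longrightarrow> x \<in> U i \<Longrightarrow> y \<in> U j \<Longrightarrow> form Q x y = 0"
    and span: "\<And>x. x \<in> carrier Q \<Longrightarrow> \<exists>u. (\<forall>i<k. u i \<in> U i) \<and> x = (\<Sum>i<k. u i)"
  shows "intertwining_isometry (orthogonal_sum k (\<lambda>i. subform Q (U i))) (sum_map k (\<lambda>i. C)) Q C
    (\<lambda>v. \<Sum>i<k. v i)"
proof -
  interpret skew_map Q C by (rule skew_map.intro[OF Q]) (unfold_locales, rule C)
  let ?S = "orthogonal_sum k (\<lambda>i. subform Q (U i))"
  have S: "v \<in> carrier ?S \<longleftrightarrow> (\<forall>i<k. v i \<in> U i) \<and> (\<forall>i\<ge>k. v i = 0)" for v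
    by (simp add: orthogonal_sum_def)
  have vQ: "v i \<in> carrier Q" if "v \<in> carrier ?S" "i < k" for v i using that S U(1) by blast
  have sumQ: "(\<Sum>i<k. v i) \<in> carrier Q" if "v \<in> carrier ?S" for v
    using vQ[OF that] by (intro carrier_sum) auto
  \<comment> \<open>Against the \<open>j\<close>-th summand, only the \<open>j\<close>-th component counts.\<close>
  have form_sum: "form Q (\<Sum>i<k. v i) y = form Q (v j) y"
    if v: "v \<in> carrier ?S" and y: "y \<in> U j" and j: "j < k" for v y j
  proof -
    have "form Q (\<Sum>i<k. v i) y = (\<Sum>i<k. form Q (v i) y)"
      using vQ[OF v] U(1)[OF j] y by (intro form_sum_left) auto
    also have "\<dots> = (\<Sum>i<k. if i = j then form Q (v j) y else 0)"
      using orth y j v S by (intro sum.cong) auto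
    finally show ?thesis using j by simp
  qed
  have iso: "form Q (\<Sum>i<k. v i) (\<Sum>i<k. w i) = form ?S v w"
    if v: "v \<in> carrier ?S" and w: "w \<in> carrier ?S" for v w
  proof -
    have "form Q (\<Sum>i<k. v i) (\<Sum>i<k. w i) = (\<Sum>j<k. form Q (\<Sum>i<k. v i) (w j))"
      using vQ[OF w] sumQ[OF v] by (intro form_sum_right) auto
    also have "\<dots> = (\<Sum>j<k. form Q (v j) (w j))"
      using form_sum[OF v] w S by (intro sum.cong) auto
    finally show ?thesis by (simp add: orthogonal_sum_def)
  qed
  have "inj_on (\<lambda>v. \<Sum>i<k. v i) (carrier ?S)"
  proof (rule inj_onI)
    fix v w assume v: "v \<in> carrier ?S" and w: "w \<in> carrier ?S" and eq: "(\<Sum>i<k. v i) = (\<Sum>i<k. w i)"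
    have "v j = w j" if j: "j < k" for j
    proof -
      interpret U: quadratic_space "subform Q (U j)" by (rule U(2)[OF j])
      have vw: "v j \<in> U j" "w j \<in> U j" using v w j S by auto
      have "v j - w j = 0"
      proof (rule U.form_nondegenerate)
        show "v j - w j \<in> carrier (subform Q (U j))" using U.carrier_diff vw by simp
        fix y assume "y \<in> carrier (subform Q (U j))"
        then have y: "y \<in> U j" by simp
        then have "form Q (v j) y = form Q (w j) y"
          using form_sum[OF v y j] form_sum[OF w y j] eq by simp
        then show "form (subform Q (U j)) (v j - w j) y = 0"
          using vQ[OF v j] vQ[OF w j] U(1)[OF j] y by (auto simp: form_diff_left)
      qed
      then show ?thesis by simp
    qed
    then show "v = w" using v w S by (metis ext not_le)
  qed
  moreover have "(\<lambda>v. \<Sum>i<k. v i) ` carrier ?S = carrier Q"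
  proof
    show "carrier Q \<subseteq> (\<lambda>v. \<Sum>i<k. v i) ` carrier ?S"
    proof
      fix x assume "x \<in> carrier Q"
      then obtain u where u: "\<forall>i<k. u i \<in> U i" "x = (\<Sum>i<k. u i)" using span by blast
      let ?u = "\<lambda>i. if i < k then u i else 0"
      have "?u \<in> carrier ?S" using u S by simp
      moreover have "x = (\<Sum>i<k. ?u i)" using u by simp
      ultimately show "x \<in> (\<lambda>v. \<Sum>i<k. v i) ` carrier ?S" by blast
    qed
  qed (use sumQ in auto)
  moreover have "linear_on (carrier ?S) (\<lambda>v. \<Sum>i<k. v i)"
    by (simp add: linear_on_def sum.distrib scaleC_fun_def complex_vector.scale_sum_right)
  moreover have "sum_map k (\<lambda>i. C) v \<in> carrier ?S" if "v \<in> carrier ?S" for v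
    using that S U(3) by (auto simp: sum_map_def skew_symmetric_map_def image_subset_iff)
  moreover have "(\<Sum>i<k. sum_map k (\<lambda>i. C) v i) = C (\<Sum>i<k. v i)" if "v \<in> carrier ?S" for v
  proof -
    have "C (\<Sum>i<k. v i) = (\<Sum>i<k. C (v i))"
      using vQ[OF that] by (intro linear_on_sum[OF subspace linear]) auto
    then show ?thesis by (simp add: sum_map_def)
  qed
  ultimately show ?thesis using iso by (simp add: intertwining_isometry_def bij_betw_def)
qed

lemma amalgamated_if_invertible:
  fixes G :: "('g::complex_vector, 'c) quadratic_lie_scheme"
  assumes G: "quadratic_lie_algebra G" and nonabelian: "\<not> abelian_lie G" and inv: "invertible_quadratic_lie G"
  shows "\<exists>k\<ge>1. \<exists>(Q :: nat \<Rightarrow> 'g quadratic_space) C.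
       (\<forall>i<k. quadratic_space (Q i) \<and> skew_symmetric_map (Q i) (C i) \<and>
          (\<exists>p\<ge>1. \<exists>lam. lam \<noteq> 0 \<and>
             i_isomorphic (double_extension (Q i) (C i)) (jordan_type p lam))) \<and>
       i_isomorphic G (amalgamated_product k Q C)"
proof -
  obtain Q :: "'g quadratic_space" and C where Q: "quadratic_space Q"
    and C: "skew_symmetric_map Q C" and bij: "bij_betw C (carrier Q) (carrier Q)"
    and iso: "i_isomorphic G (double_extension Q C)"
    using inv unfolding invertible_quadratic_lie_def by blast
  interpret skew_map Q C by (rule skew_map.intro[OF Q]) (unfold_locales, rule C)
  have inj: "\<forall>x\<in>carrier Q. C x = 0 \<longrightarrow> x = 0"
  proof (intro ballI impI)
    fix x assume x: "x \<in> carrier Q" "C x = 0"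
    have "C x = C 0" using x pow_zero[of 1] by simp
    then show "x = 0"
      using x(1) by (rule inj_onD[OF bij_betw_imp_inj_on[OF bij] _ _ carrier_zero])
  qed
  obtain n where "dim_at_most (carrier Q) n" using dim_at_most_carrier by blast
  from orthogonal_jordan_decomposition[OF skew_map_axioms inj this]
  obtain k :: nat and U where all: "\<forall>i<k. jordan_summand Q C (U i)"
    "\<forall>i<k. \<forall>j<k. i \<noteq> j \<longrightarrow> (\<forall>x\<in>U i. \<forall>y\<in>U j. form Q x y = 0)"
    "\<forall>x\<in>carrier Q. \<exists>u. (\<forall>i<k. u i \<in> U i) \<and> x = (\<Sum>i<k. u i)"
    by (elim exE conjE) (rule that)
  have U: "jordan_summand Q C (U i)" if "i < k" for i using all(1) that by blast
  let ?Q = "\<lambda>i. subform Q (U i)"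
  have k: "k \<ge> 1"
  proof (rule ccontr)
    \<comment> \<open>Without summands the double extension is an abelian hyperbolic plane.\<close>
    assume "\<not> k \<ge> 1"
    then have "k = 0" by simp
    then have "carrier Q = {0}" using all(3) carrier_zero by auto
    then have zero: "bracket (double_extension Q C) u v = 0"
      if "u \<in> carrier (double_extension Q C)" "v \<in> carrier (double_extension Q C)" for u v
      using that pow_zero[of 1] form_zero_left[OF carrier_zero] by (auto simp: zero_prod_def)
    obtain f where f: "bij_betw f (carrier G) (carrier (double_extension Q C))"
      "linear_on (carrier G) f"
      "\<forall>x\<in>carrier G. \<forall>y\<in>carrier G. f (bracket G x y) = bracket (double_extension Q C) (f x) (f y)"
      using iso unfolding i_isomorphic_def by blast
    have f0: "f 0 = 0" using f(2) linear_on_zero G unfolding quadratic_lie_algebra_def quadratic_space_def by blast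
    have "bracket G x y = 0" if xy: "x \<in> carrier G" "y \<in> carrier G" for x y
    proof (rule inj_onD[OF bij_betw_imp_inj_on[OF f(1)]])
      show "f (bracket G x y) = f 0"
        using f(3) f0 xy zero bij_betw_apply[OF f(1)] by simp
      show "bracket G x y \<in> carrier G" using quadratic_lie_algebra.bracket_closed[OF G xy] .
      show "0 \<in> carrier G"
        using G unfolding quadratic_lie_algebra_def quadratic_space_def
        by (blast intro: complex_vector.subspace_0)
    qed
    then show False using nonabelian by (simp add: abelian_lie_def)
  qed
  have "intertwining_isometry (orthogonal_sum k ?Q) (sum_map k (\<lambda>i. C)) Q C (\<lambda>v. \<Sum>i<k. v i)"
  proof (rule intertwining_isometry_orthogonal_sum[OF Q C])
    show "form Q x y = 0" if "i < k" "j < k" "i \<noteq> j" "x \<in> U i" "y \<in> U j" for i j x y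
      using all(2) that by blast
  qed (use U all(3) in \<open>auto simp: jordan_summand_def\<close>)
  moreover have "complex_vector.subspace (carrier (?Q i))" if "i < k" for i
    using U[OF that] by (simp add: jordan_summand_def quadratic_space_def)
  ultimately have conj: "intertwining_isometry Q C (orthogonal_sum k ?Q) (sum_map k (\<lambda>i. C))
      (inv_into (carrier (orthogonal_sum k ?Q)) (\<lambda>v. \<Sum>i<k. v i))"
    by (intro intertwining_isometry_inv subspace_orthogonal_sum)
  have "i_isomorphic G (amalgamated_product k ?Q (\<lambda>i. C))"
    unfolding amalgamated_product_def
    by (rule i_isomorphic_trans[OF iso double_extension_intertwining[OF subspace_carrier conj]])
  then show ?thesis
    using k U unfolding jordan_summand_def
    by (intro exI[of _ k] conjI exI[of _ ?Q] exI[of _ "\<lambda>i. C"]) blast+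
qed

theorem proposition7p7:
  fixes G :: "'g::complex_vector quadratic_lie"
  assumes "quadratic_lie_algebra G"
    and "solvable_lie G"
    and "singular_lie G"
  shows "invertible_quadratic_lie G \<longleftrightarrow>
    (\<exists>k\<ge>1. \<exists>(Q :: nat \<Rightarrow> 'g quadratic_space) C.
       (\<forall>i<k. quadratic_space (Q i) \<and> skew_symmetric_map (Q i) (C i) \<and>
          (\<exists>p\<ge>1. \<exists>lam. lam \<noteq> 0 \<and>
             i_isomorphic (double_extension (Q i) (C i)) (jordan_type p lam))) \<and>
       i_isomorphic G (amalgamated_product k Q C))"
proof
  assume "invertible_quadratic_lie G"
  moreover have "\<not> abelian_lie G" using assms(3) by (simp add: singular_lie_def)
  ultimately show "\<exists>k\<ge>1. \<exists>(Q :: nat \<Rightarrow> 'g quadratic_space) C.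
       (\<forall>i<k. quadratic_space (Q i) \<and> skew_symmetric_map (Q i) (C i) \<and>
          (\<exists>p\<ge>1. \<exists>lam. lam \<noteq> 0 \<and>
             i_isomorphic (double_extension (Q i) (C i)) (jordan_type p lam))) \<and>
       i_isomorphic G (amalgamated_product k Q C)"
    by (rule amalgamated_if_invertible[OF assms(1), rotated])
next
  assume "\<exists>k\<ge>1. \<exists>(Q :: nat \<Rightarrow> 'g quadratic_space) C.
       (\<forall>i<k. quadratic_space (Q i) \<and> skew_symmetric_map (Q i) (C i) \<and>
          (\<exists>p\<ge>1. \<exists>lam. lam \<noteq> 0 \<and>
             i_isomorphic (double_extension (Q i) (C i)) (jordan_type p lam))) \<and>
       i_isomorphic G (amalgamated_product k Q C)"
  then obtain k and Q :: "nat \<Rightarrow> 'g quadratic_space" and C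
    where Q: "\<And>i. i < k \<Longrightarrow> quadratic_space (Q i)"
      and C: "\<And>i. i < k \<Longrightarrow> skew_symmetric_map (Q i) (C i)"
      and jordan: "\<And>i. i < k \<Longrightarrow> \<exists>p\<ge>1. \<exists>lam. lam \<noteq> 0 \<and>
             i_isomorphic (double_extension (Q i) (C i)) (jordan_type p lam)"
      and iso: "i_isomorphic G (amalgamated_product k Q C)"
    by blast
  have "bij_betw (C i) (carrier (Q i)) (carrier (Q i))" if "i < k" for i
    using bijective_if_jordan_type[OF Q[OF that] C[OF that]] jordan[OF that] by blast
  then have bij: "bij_betw (sum_map k C) (carrier (orthogonal_sum k Q)) (carrier (orthogonal_sum k Q))"
    by (rule bij_sum_map)
  have sub: "complex_vector.subspace (carrier (orthogonal_sum k Q))"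
    using Q by (intro subspace_orthogonal_sum) (auto simp: quadratic_space_def)
  show "invertible_quadratic_lie G"
  proof (rule invertible_if_isomorphic_to_double_extension[OF _ sub skew_sum_map[OF C] bij])
    show "quadratic_space G" using assms(1) by (simp add: quadratic_lie_algebra_def)
    show "i_isomorphic G (double_extension (orthogonal_sum k Q) (sum_map k C))"
      using iso by (simp add: amalgamated_product_def)
  qed
qed

end
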